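(* Let $g(k)$ denote the smallest integer $N$ such that for every $n\ge N$ and every sequence of non-negative integers $(e_1,\dots,e_k)$ with $\sum_{i=1}^k e_i=\binom{n}{2}$, there exists a Gallai colouring of $K_n$ with colour distribution sequence $(e_1,\dots,e_k)$. Then \[g(k)=\Theta\!\left(\frac{k^{1.5}}{(\log k)^{0.5}}\right).\]
   Context: An edge colouring of $K_n$ with $k$ colours is a map $c:E(K_n)\to[k]$. It has colour distribution sequence $(e_1,\dots,e_k)$ if exactly $e_i$ edges receive colour $i$ for each $i\in[k]$. A Gallai colouring is an edge colouring of $K_n$ containing no rainbow triangle, i.e. no triangle whose three edges have three distinct colours. It is known (and used in the definition) that such an $N$ exists for every $k\ge 2$. *)

theory Defs
  imports Complex_Main "HOL-Library.Ramsey" "HOL-Library.Landau_Symbols"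
begin

definition complete_edges :: "nat \<Rightarrow> nat set set" where
  "complete_edges n = nsets {..<n} 2"

text \<open>Only the values of a colouring on \<open>complete_edges n\<close> are relevant below.\<close>

definition edge_colouring :: "nat \<Rightarrow> nat \<Rightarrow> (nat set \<Rightarrow> nat) \<Rightarrow> bool" where
  "edge_colouring n k c \<longleftrightarrow> c \<in> complete_edges n \<rightarrow> {1..k}"

definition rainbow_triangle :: "nat \<Rightarrow> (nat set \<Rightarrow> nat) \<Rightarrow> nat \<Rightarrow> nat \<Rightarrow> nat \<Rightarrow> bool" where
  "rainbow_triangle n c x y z \<longleftrightarrow>
     x < n \<and> y < n \<and> z < n \<and> x \<noteq> y \<and> y \<noteq> z \<and> x \<noteq> z \<and>
     c {x, y} \<noteq> c {y, z} \<and> c {y, z} \<noteq> c {x, z} \<and> c {x, y} \<noteq> c {x, z}"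

definition gallai_colouring :: "nat \<Rightarrow> nat \<Rightarrow> (nat set \<Rightarrow> nat) \<Rightarrow> bool" where
  "gallai_colouring n k c \<longleftrightarrow>
     edge_colouring n k c \<and> (\<nexists>x y z. rainbow_triangle n c x y z)"

definition has_colour_distribution ::
    "nat \<Rightarrow> nat \<Rightarrow> (nat set \<Rightarrow> nat) \<Rightarrow> (nat \<Rightarrow> nat) \<Rightarrow> bool" where
  "has_colour_distribution n k c e \<longleftrightarrow>
     (\<forall>i\<in>{1..k}. card {d \<in> complete_edges n. c d = i} = e i)"

definition gallai_threshold :: "nat \<Rightarrow> nat \<Rightarrow> bool" where
  "gallai_threshold k N \<longleftrightarrow>
     (\<forall>n\<ge>N. \<forall>e :: nat \<Rightarrow> nat. (\<Sum>i=1..k. e i) = n choose 2 \<longrightarrow>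
        (\<exists>c. gallai_colouring n k c \<and> has_colour_distribution n k c e))"

definition gallai_g :: "nat \<Rightarrow> nat" where
  "gallai_g k = (LEAST N. gallai_threshold k N)"

end

(* A Gallai colouring with two or more vertices has a cut on which at most two colours appear,
   both of them connected and spanning.

   Lower bound: give k/2 "small" colours about k/4 edges each and let the others have M ~ n^2/k
   edges.  As long as more than k/4 + 1 vertices are left, no small colour spans, so repeatedly
   cutting off the smaller side, of size a out of s, costs a s <= 4M and puts at most
   a^2/2 <= 2M a/s edges of small colours inside that side.  Since the sum of a/s is at most ln n,
   the small colours fit only if k^2 is O(M ln n), that is, if n^2 ln k is at least of order k^3.

   Upper bound: split off blocks of a vertices, joined to the rest in one colour.  The
   inside of a block consists of stars with 1, ..., a - 1 edges whose colours are free, and a greedy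
   argument completes the colouring once blocks of suitable sizes contain 2k^2 edges in total.
   With m ~ n^2/(16k), use a block of size about m/s on a colour with at least m edges left, but
   first exhaust by single vertices the colours that have between s - 1 and m edges left.  Thus
   each block uses up about m edges of K_s and gains about m^2/s^2 of block edges, which sums up
   to order m ln k. *)
theory Submission
  imports Defs "HOL-Library.Multiset" "HOL-Real_Asymp.Real_Asymp"
begin

section \<open>Packing stars and adding blocks\<close>

text \<open>\<open>packs k M d\<close>: the numbers in \<open>M\<close> can be handed out to the colours \<open>1..k\<close> so that
  colour \<open>i\<close> receives the total \<open>d i\<close>.\<close>

inductive packs :: "nat \<Rightarrow> nat multiset \<Rightarrow> (nat \<Rightarrow> nat) \<Rightarrow> bool" for k where
  packs_empty: "(\<forall>i\<in>{1..k}. d i = 0) \<Longrightarrow> packs k {#} d"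
| packs_add: "i \<in> {1..k} \<Longrightarrow> x \<le> d i \<Longrightarrow> packs k M (d(i := d i - x)) \<Longrightarrow> packs k (add_mset x M) d"

lemma packs_union_split:
  assumes "packs k N d" "N = A + B"
  shows "\<exists>d1 d2. packs k A d1 \<and> packs k B d2 \<and> (\<forall>i\<in>{1..k}. d i = d1 i + d2 i)"
  using assms
proof (induction arbitrary: A B rule: packs.induct)
  case (packs_empty d)
  then show ?case
    by (intro exI[of _ "\<lambda>_. 0"]) (auto intro!: packs.packs_empty)
next
  case (packs_add i x d M)
  have step: "\<exists>d1 d2. packs k (add_mset x A') d1 \<and> packs k B' d2 \<and> (\<forall>i\<in>{1..k}. d i = d1 i + d2 i)"
    if eq: "M = A' + B'" for A' B'
  proof -
    from packs_add.IH[OF eq] obtain d1 d2 where d: "packs k A' d1" "packs k B' d2"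
      "\<forall>j\<in>{1..k}. (d(i := d i - x)) j = d1 j + d2 j" by blast
    have "packs k (add_mset x A') (d1(i := d1 i + x))"
      by (rule packs.packs_add[of i]) (use packs_add d in auto)
    moreover have "\<forall>j\<in>{1..k}. d j = (d1(i := d1 i + x)) j + d2 j"
    proof
      fix j assume "j \<in> {1..k}"
      with d(3) have "(d(i := d i - x)) j = d1 j + d2 j" by blast
      with packs_add(2) show "d j = (d1(i := d1 i + x)) j + d2 j" by (cases "j = i") auto
    qed
    ultimately show ?thesis using d by blast
  qed
  have "x \<in># A \<or> x \<in># B" using packs_add.prems by (metis union_iff union_single_eq_member)
  then show ?case
  proof
    assume "x \<in># A"
    then obtain A' where A': "A = add_mset x A'" by (metis multi_member_split)
    with packs_add.prems have "M = A' + B" by simp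
    from step[OF this] A' show ?case by blast
  next
    assume "x \<in># B"
    then obtain B' where B': "B = add_mset x B'" by (metis multi_member_split)
    with packs_add.prems have "M = B' + A" by (simp add: add.commute)
    from step[OF this] B' show ?case by (metis add.commute)
  qed
qed

lemma packs_singleton:
  assumes "packs k {#x#} d"
  shows "\<exists>i\<in>{1..k}. \<forall>j\<in>{1..k}. d j = (if j = i then x else 0)"
  using assms
proof (cases rule: packs.cases)
  case (packs_add i y M)
  then have *: "y = x" "M = {#}" by auto
  with packs_add have "packs k {#} (d(i := d i - x))" by simp
  then have z: "\<forall>j\<in>{1..k}. (d(i := d i - x)) j = 0" by (cases rule: packs.cases) auto
  show ?thesis
  proof (rule bexI[of _ i], rule ballI)
    fix j assume "j \<in> {1..k}"
    with z have "(d(i := d i - x)) j = 0" by blast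
    with packs_add * show "d j = (if j = i then x else 0)" by (cases "j = i") auto
  qed (use packs_add in auto)
qed auto

text \<open>The star sizes inside one block are distinct, so the way they were handed out is a
  function of the size.\<close>

lemma packs_mset_setD:
  assumes "finite F" "packs k (mset_set F) d"
  shows "\<exists>f. (\<forall>j\<in>F. f j \<in> {1..k}) \<and> (\<forall>i\<in>{1..k}. d i = (\<Sum>j\<in>F. if f j = i then j else 0))"
  using assms
proof (induction F arbitrary: d rule: finite_induct)
  case empty
  then have "\<forall>j\<in>{1..k}. d j = 0" by (auto elim: packs.cases)
  then show ?case by auto
next
  case (insert x F)
  then have "packs k ({#x#} + mset_set F) d" by simp
  from packs_union_split[OF this refl] obtain d1 d2 where
    d: "packs k {#x#} d1" "packs k (mset_set F) d2" "\<forall>i\<in>{1..k}. d i = d1 i + d2 i" by blast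
  from packs_singleton[OF d(1)] obtain i where
    i: "i \<in> {1..k}" "\<forall>j\<in>{1..k}. d1 j = (if j = i then x else 0)" by blast
  from insert.IH[OF d(2)] obtain f where
    f: "\<forall>j\<in>F. f j \<in> {1..k}" "\<forall>i\<in>{1..k}. d2 i = (\<Sum>j\<in>F. if f j = i then j else 0)" by blast
  have eq: "(\<Sum>j\<in>F. if (f(x := i)) j = l then j else 0) = (\<Sum>j\<in>F. if f j = l then j else 0)" for l
    using insert.hyps by (intro sum.cong) auto
  show ?case
  proof (intro exI[of _ "f(x := i)"] conjI ballI)
    fix l assume l: "l \<in> {1..k}"
    have "d l = (if l = i then x else 0) + (\<Sum>j\<in>F. if f j = l then j else 0)"
      using l d(3) i(2) f(2) by simp
    then show "d l = (\<Sum>j\<in>insert x F. if (f(x := i)) j = l then j else 0)"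
      using insert.hyps eq[of l] by auto
  qed (use i f in auto)
qed

text \<open>Handing out the largest number first never gets stuck: if all of the \<open>k\<close> remaining
  demands were below the current number \<open>x\<close>, their total would be at most \<open>k * (x - 1)\<close>.\<close>

lemma packs_greedy:
  assumes "\<forall>x\<in>#N. k * (x - 1) \<le> sum_mset (filter_mset (\<lambda>y. y < x) N)"
    and "(\<Sum>i=1..k. d i) = sum_mset N" and "\<forall>x\<in>#N. 1 \<le> x"
  shows "packs k N d"
  using assms
proof (induction "size N" arbitrary: N d)
  case 0
  then show ?case by (auto intro!: packs_empty)
next
  case (Suc l)
  then have ne: "N \<noteq> {#}" by auto
  define x where "x = Max (set_mset N)"
  have x: "x \<in># N" "\<And>y. y \<in># N \<Longrightarrow> y \<le> x" using ne by (auto simp: x_def)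
  obtain N' where N': "N = add_mset x N'" using x(1) by (metis multi_member_split)
  have sub: "sum_mset (filter_mset (\<lambda>y. y < x) N) \<le> sum_mset N'"
  proof -
    have "filter_mset (\<lambda>y. y < x) N = filter_mset (\<lambda>y. y < x) N'" using N' by simp
    moreover have "sum_mset N' = sum_mset (filter_mset (\<lambda>y. y < x) N') + sum_mset (filter_mset (\<lambda>y. \<not> y < x) N')"
      by (metis multiset_partition sum_mset.union)
    ultimately show ?thesis by simp
  qed
  have "\<exists>i\<in>{1..k}. x \<le> d i"
  proof (rule ccontr)
    assume "\<not> ?thesis"
    then have "d i \<le> x - 1" if "i \<in> {1..k}" for i
    proof -
      have "\<not> x \<le> d i" using \<open>\<not> (\<exists>i\<in>{1..k}. x \<le> d i)\<close> that by blast
      then show ?thesis by linarith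
    qed
    then have "(\<Sum>i=1..k. d i) \<le> (\<Sum>i=1..k. x - 1)" by (rule sum_mono)
    also have "\<dots> = k * (x - 1)" by simp
    also have "\<dots> \<le> sum_mset N'" using Suc.prems(1) x(1) sub le_trans by blast
    also have "\<dots> < sum_mset N" using N' Suc.prems(3) x(1) by fastforce
    finally show False using Suc.prems(2) by simp
  qed
  then obtain i where i: "i \<in> {1..k}" "x \<le> d i" by blast
  have "packs k N' (d(i := d i - x))"
  proof (rule Suc.hyps(1))
    show "l = size N'" using Suc.hyps(2) N' by simp
    show "\<forall>y\<in>#N'. k * (y - 1) \<le> sum_mset (filter_mset (\<lambda>z. z < y) N')"
    proof
      fix y assume "y \<in># N'"
      then have y: "y \<in># N" using N' by simp
      \<comment> \<open>The maximum \<open>x\<close> is not below any \<open>y\<close> in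
        \<open>N\<close>, so deleting it leaves the supply below \<open>y\<close> intact.\<close>
      then have "filter_mset (\<lambda>z. z < y) N = filter_mset (\<lambda>z. z < y) N'"
        using N' x(2)[OF y] by simp
      then show "k * (y - 1) \<le> sum_mset (filter_mset (\<lambda>z. z < y) N')"
        using Suc.prems(1) y by metis
    qed
    have "(\<Sum>j=1..k. d j) = d i + (\<Sum>j\<in>{1..k} - {i}. d j)"
      using i by (intro sum.remove) auto
    moreover have "(\<Sum>j=1..k. (d(i := d i - x)) j) = (d i - x) + (\<Sum>j\<in>{1..k} - {i}. d j)"
      using i by (subst sum.remove[of _ i]) auto
    ultimately show "(\<Sum>j=1..k. (d(i := d i - x)) j) = sum_mset N'"
      using Suc.prems(2) N' i by simp
    show "\<forall>x\<in>#N'. 1 \<le> x" using Suc.prems(3) N' by simp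
  qed
  then show ?case using N' packs_add i by blast
qed

section \<open>Edges counted at their larger endpoint, and the Gallai condition on increasing
  triples\<close>

lemma card_edges_coloured:
  "card {d \<in> complete_edges n. c d = i} = (\<Sum>v<n. card {u. u < v \<and> c {u, v} = i})"
proof -
  have "bij_betw (\<lambda>(v, u). {u, v}) (SIGMA v:{..<n}. {u. u < v \<and> c {u, v} = i})
          {d \<in> complete_edges n. c d = i}"
    unfolding bij_betw_def
  proof
    show "inj_on (\<lambda>(v, u). {u, v}) (SIGMA v:{..<n}. {u. u < v \<and> c {u, v} = i})"
      by (auto simp: inj_on_def doubleton_eq_iff)
    show "(\<lambda>(v, u). {u, v}) ` (SIGMA v:{..<n}. {u. u < v \<and> c {u, v} = i}) = {d \<in> complete_edges n. c d = i}"
    proof (intro equalityI subsetI)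
      fix d assume "d \<in> {d \<in> complete_edges n. c d = i}"
      then obtain x y where xy: "d = {x, y}" "x \<noteq> y" "x < n" "y < n" "c d = i"
        by (auto simp: complete_edges_def nsets_def card_2_iff)
      show "d \<in> (\<lambda>(v, u). {u, v}) ` (SIGMA v:{..<n}. {u. u < v \<and> c {u, v} = i})"
      proof (cases "x < y")
        case True
        then show ?thesis using xy by (intro image_eqI[of _ _ "(y, x)"]) auto
      next
        case False
        then show ?thesis using xy
          by (intro image_eqI[of _ _ "(x, y)"]) (auto simp: insert_commute)
      qed
    qed (auto simp: complete_edges_def nsets_def)
  qed
  then have "card {d \<in> complete_edges n. c d = i} = card (SIGMA v:{..<n}. {u. u < v \<and> c {u, v} = i})"
    by (simp add: bij_betw_same_card)
  also have "\<dots> = (\<Sum>v<n. card {u. u < v \<and> c {u, v} = i})"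
    by (subst card_SigmaI) auto
  finally show ?thesis .
qed

lemma gallai_colouringI:
  assumes "\<And>u v. u < v \<Longrightarrow> v < n \<Longrightarrow> c {u, v} \<in> {1..k}"
    and "\<And>u v w. u < v \<Longrightarrow> v < w \<Longrightarrow> w < n \<Longrightarrow>
      c {u, v} = c {u, w} \<or> c {u, v} = c {v, w} \<or> c {u, w} = c {v, w}"
  shows "gallai_colouring n k c"
  unfolding gallai_colouring_def
proof
  show "edge_colouring n k c"
    unfolding edge_colouring_def
  proof
    fix d assume "d \<in> complete_edges n"
    then obtain x y where xy: "d = {x, y}" "x \<noteq> y" "x < n" "y < n"
      by (auto simp: complete_edges_def nsets_def card_2_iff)
    then show "c d \<in> {1..k}"
      using assms(1)[of x y] assms(1)[of y x] by (metis insert_commute nat_neq_iff)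
  qed
  show "\<nexists>x y z. rainbow_triangle n c x y z"
  proof
    assume "\<exists>x y z. rainbow_triangle n c x y z"
    then obtain x y z where r: "rainbow_triangle n c x y z" by blast
    consider "x < y \<and> y < z" | "x < z \<and> z < y" | "y < x \<and> x < z" | "y < z \<and> z < x"
      | "z < x \<and> x < y" | "z < y \<and> y < x"
      using r unfolding rainbow_triangle_def by linarith
    then show False
    proof cases
      case 1
      then show ?thesis using r assms(2)[of x y z]
        by (auto simp: rainbow_triangle_def insert_commute)
    next
      case 2
      then show ?thesis using r assms(2)[of x z y]
        by (auto simp: rainbow_triangle_def insert_commute)
    next
      case 3
      then show ?thesis using r assms(2)[of y x z]
        by (auto simp: rainbow_triangle_def insert_commute)
    next
      case 4
      then show ?thesis using r assms(2)[of y z x]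
        by (auto simp: rainbow_triangle_def insert_commute)
    next
      case 5
      then show ?thesis using r assms(2)[of z x y]
        by (auto simp: rainbow_triangle_def insert_commute)
    next
      case 6
      then show ?thesis using r assms(2)[of z y x]
        by (auto simp: rainbow_triangle_def insert_commute)
    qed
  qed
qed

lemma gallai_colouringD:
  assumes "gallai_colouring n k c"
  shows "u < v \<Longrightarrow> v < n \<Longrightarrow> c {u, v} \<in> {1..k}"
    and "u < v \<Longrightarrow> v < w \<Longrightarrow> w < n \<Longrightarrow>
      c {u, v} = c {u, w} \<or> c {u, v} = c {v, w} \<or> c {u, w} = c {v, w}"
proof -
  show "c {u, v} \<in> {1..k}" if "u < v" "v < n"
  proof -
    have "{u, v} \<in> complete_edges n" using that by (auto simp: complete_edges_def nsets_def)
    then show ?thesis using assms by (auto simp: gallai_colouring_def edge_colouring_def)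
  qed
  show "c {u, v} = c {u, w} \<or> c {u, v} = c {v, w} \<or> c {u, w} = c {v, w}"
    if "u < v" "v < w" "w < n"
  proof -
    have "\<not> rainbow_triangle n c u v w" using assms by (auto simp: gallai_colouring_def)
    then show ?thesis using that unfolding rainbow_triangle_def by auto
  qed
qed

text \<open>\<open>M\<close> lists the stars, by number of edges, that blocks removed earlier still offer to any colour.\<close>

definition realises :: "nat \<Rightarrow> nat \<Rightarrow> (nat \<Rightarrow> nat) \<Rightarrow> nat multiset \<Rightarrow> bool" where
  "realises k s e M \<longleftrightarrow> (\<exists>c d1 d2. gallai_colouring s k c \<and> has_colour_distribution s k c d1 \<and>
     packs k M d2 \<and> (\<forall>i\<in>{1..k}. e i = d1 i + d2 i))"

lemma realises_emptyD:
  assumes "realises k s e {#}"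
  shows "\<exists>c. gallai_colouring s k c \<and> has_colour_distribution s k c e"
proof -
  from assms obtain c d1 d2 where c: "gallai_colouring s k c" "has_colour_distribution s k c d1"
     "packs k {#} d2" "\<forall>i\<in>{1..k}. e i = d1 i + d2 i" unfolding realises_def by blast
  from c(3) have "\<forall>i\<in>{1..k}. d2 i = 0" by (cases rule: packs.cases) auto
  with c show ?thesis unfolding has_colour_distribution_def by auto
qed

text \<open>A block of \<open>a\<close> new vertices sends colour \<open>i0\<close> to all old vertices; inside it the \<open>j\<close>-th
  vertex forms a monochromatic star with the \<open>j\<close> vertices of the block before it.\<close>

lemma realises_block:
  assumes i0: "i0 \<in> {1..k}" and le: "a * s \<le> e i0"
    and re: "realises k s (e(i0 := e i0 - a * s)) (M + mset_set {1..<a})"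
  shows "realises k (s + a) e M"
proof -
  from re obtain c d1 d2 where c: "gallai_colouring s k c" "has_colour_distribution s k c d1"
     "packs k (M + mset_set {1..<a}) d2" "\<forall>i\<in>{1..k}. (e(i0 := e i0 - a * s)) i = d1 i + d2 i"
    unfolding realises_def by blast
  from packs_union_split[OF c(3) refl] obtain d3 d4 where
    d: "packs k M d3" "packs k (mset_set {1..<a}) d4" "\<forall>i\<in>{1..k}. d2 i = d3 i + d4 i" by blast
  from packs_mset_setD[OF _ d(2)] obtain f where
    f: "\<forall>j\<in>{1..<a}. f j \<in> {1..k}" "\<forall>i\<in>{1..k}. d4 i = (\<Sum>j\<in>{1..<a}. if f j = i then j else 0)"
    by auto
  \<comment> \<open>\<open>Min\<close> and \<open>Max\<close> recover the endpoints
    \<open>u < v\<close>. Old edges keep their colour, edges leaving the block get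
    \<open>i0\<close>, and inside the block \<open>v\<close> is the centre of a star.\<close>
  define c' where "c' D = (let u = Min D; v = Max D in
      if v < s then c {u, v} else if u < s then i0 else f (v - s))" for D :: "nat set"
  have c': "c' {u, v} = (if v < s then c {u, v} else if u < s then i0 else f (v - s))"
    if "u < v" for u v
    using that by (simp add: c'_def Let_def min_def max_def)
  have g: "gallai_colouring (s + a) k c'"
  proof (rule gallai_colouringI)
    fix u v assume uv: "u < v" "v < s + a"
    have "f (v - s) \<in> {1..k}" if "\<not> u < s"
      using that uv by (intro f(1)[rule_format]) auto
    then show "c' {u, v} \<in> {1..k}"
      using uv i0 gallai_colouringD(1)[OF c(1), of u v] by (auto simp: c')
  next
    \<comment> \<open>With only \<open>w\<close> new, both edges at \<open>w\<close> are
      \<open>i0\<close>; with \<open>v\<close> and \<open>w\<close> new, both edges at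
      \<open>u\<close> are \<open>i0\<close>; with all three new, both edges at \<open>w\<close>
      belong to its star.\<close>
    fix u v w assume "u < v" "v < w" "w < s + a"
    then show "c' {u, v} = c' {u, w} \<or> c' {u, v} = c' {v, w} \<or> c' {u, w} = c' {v, w}"
      using gallai_colouringD(2)[OF c(1), of u v w] by (auto simp: c')
  qed
  have "card {D \<in> complete_edges (s + a). c' D = i} + d3 i = e i" if i: "i \<in> {1..k}" for i
  proof -
    have "card {D \<in> complete_edges (s + a). c' D = i} = (\<Sum>v<s + a. card {u. u < v \<and> c' {u, v} = i})"
      by (rule card_edges_coloured)
    \<comment> \<open>The new vertices carry the largest numbers, so counting at the larger endpoint
      separates the old edges from those that the block adds.\<close>
    also have "{..<s + a} = {..<s} \<union> (\<lambda>j. s + j) ` {..<a}"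
    proof (intro equalityI subsetI)
      fix x assume "x \<in> {..<s + a}"
      then show "x \<in> {..<s} \<union> (\<lambda>j. s + j) ` {..<a}"
        by (cases "x < s") (auto intro!: image_eqI[of _ _ "x - s"])
    qed auto
    also have "(\<Sum>v\<in>{..<s} \<union> (\<lambda>j. s + j) ` {..<a}. card {u. u < v \<and> c' {u, v} = i}) =
       (\<Sum>v<s. card {u. u < v \<and> c' {u, v} = i}) +
       (\<Sum>j<a. card {u. u < s + j \<and> c' {u, s + j} = i})"
      by (subst sum.union_disjoint) (auto simp: sum.reindex)
    also have "(\<Sum>v<s. card {u. u < v \<and> c' {u, v} = i}) = (\<Sum>v<s. card {u. u < v \<and> c {u, v} = i})"
      by (intro sum.cong arg_cong[of _ _ card]) (auto simp: c')
    also have "\<dots> = d1 i"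
      using c(2) i card_edges_coloured[of s c i] by (auto simp: has_colour_distribution_def)
    also have "(\<Sum>j<a. card {u. u < s + j \<and> c' {u, s + j} = i}) =
        (\<Sum>j<a. (if i = i0 then s else 0) + (if f j = i then j else 0))"
    proof (intro sum.cong refl)
      fix j
      have "{u. u < s + j \<and> c' {u, s + j} = i} =
         (if i = i0 then {..<s} else {}) \<union> (if f j = i then {s..<s + j} else {})"
        by (auto simp: c' split: if_splits)
      also have "card \<dots> = (if i = i0 then s else 0) + (if f j = i then j else 0)"
        by (subst card_Un_disjoint) auto
      finally show "card {u. u < s + j \<and> c' {u, s + j} = i} =
        (if i = i0 then s else 0) + (if f j = i then j else 0)" .
    qed
    also have "\<dots> = (if i = i0 then a * s else 0) + (\<Sum>j<a. if f j = i then j else 0)"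
      by (simp add: sum.distrib)
    \<comment> \<open>The first vertex of the block centres an empty star, so the value
      \<open>f 0\<close> never counts.\<close>
    also have "(\<Sum>j<a. if f j = i then j else 0) = (\<Sum>j\<in>{1..<a}. if f j = i then j else 0)"
      by (rule sum.mono_neutral_right) auto
    also have "\<dots> = d4 i" using f(2) i by simp
    finally have "card {D \<in> complete_edges (s + a). c' D = i} =
        d1 i + ((if i = i0 then a * s else 0) + d4 i)" .
    moreover have "(e(i0 := e i0 - a * s)) i = d1 i + (d3 i + d4 i)" using c(4) d(3) i by simp
    ultimately show ?thesis using le by (cases "i = i0") auto
  qed
  then show ?thesis
    unfolding realises_def using g d(1)
    by (intro exI[of _ c'] exI[of _ "\<lambda>i. card {D \<in> complete_edges (s + a). c' D = i}"] exI[of _ d3])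
       (auto simp: has_colour_distribution_def)
qed

text \<open>The remaining \<open>s\<close> vertices form one last block on top of the empty graph.
  It has no old vertices to be joined to, so only its stars have to be packed.\<close>

lemma realises_packs:
  assumes "packs k (M + mset_set {1..<s}) e" "1 \<le> k"
  shows "realises k s e M"
proof -
  have "gallai_colouring 0 k (\<lambda>_. 1)" by (rule gallai_colouringI) auto
  moreover have "has_colour_distribution 0 k (\<lambda>_. 1) (\<lambda>_. 0)"
    by (auto simp: has_colour_distribution_def card_edges_coloured)
  ultimately have "realises k 0 e (M + mset_set {1..<s})"
    unfolding realises_def using assms by fastforce
  then show ?thesis using realises_block[of 1 k s 0 e M] assms by simp
qed

text \<open>\<open>B\<close> collects the sizes of the blocks removed so far; the items are the
  stars that these blocks offer.\<close>

definition items :: "nat multiset \<Rightarrow> nat multiset" where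
  "items B = (\<Sum>a\<in>#B. mset_set {1..<a})"

definition capacity :: "nat multiset \<Rightarrow> nat" where
  "capacity B = (\<Sum>a\<in>#B. a choose 2)"

lemma items_simps [simp]:
  "items {#} = {#}" "items (add_mset a B) = items B + mset_set {1..<a}"
  by (simp_all add: items_def)

lemma capacity_simps [simp]:
  "capacity {#} = 0" "capacity (add_mset a B) = capacity B + (a choose 2)"
  by (simp_all add: capacity_def)

lemma sum_atLeast1_lessThan: "(\<Sum>i\<in>{1..<a}. i) = a choose 2"
  by (induction a) (auto simp: atLeastLessThanSuc numeral_2_eq_2)

lemma sum_mset_items: "sum_mset (items B) = capacity B"
proof (induction B)
  case (add a B)
  have "sum_mset (mset_set {1..<a}) = a choose 2"
    using sum_atLeast1_lessThan[of a] by (simp add: sum_unfold_sum_mset)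
  with add show ?case by simp
qed simp

section \<open>The descent and its potential\<close>

lemma choose_two_add: "(s + a) choose 2 = (s choose 2) + (a choose 2) + a * s" for s a :: nat
  by (induction a) (auto simp: numeral_2_eq_2)

lemma real_choose_two: "real (n choose 2) = real n * (real n - 1) / 2"
proof (induction n)
  case (Suc n)
  have "real (Suc n choose 2) = real n + real (n choose 2)" by (simp add: numeral_2_eq_2)
  with Suc show ?case by (simp add: field_simps)
qed simp

text \<open>Potential of the descent: moving a star out of a colour below \<open>m\<close> does not change it.\<close>

definition surplus :: "nat \<Rightarrow> nat \<Rightarrow> nat \<Rightarrow> (nat \<Rightarrow> nat) \<Rightarrow> real" where
  "surplus k m s e = real (s choose 2) - (\<Sum>i=1..k. if e i < m then real (e i) else 0)"

lemma sum_fun_upd: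
  fixes f :: "nat \<Rightarrow> 'a::ab_group_add"
  assumes "i \<in> A" "finite A"
  shows "(\<Sum>j\<in>A. g j ((e(i := x)) j)) = (\<Sum>j\<in>A. g j (e j)) - g i (e i) + (g i x :: 'a)"
proof -
  have "(\<Sum>j\<in>A. g j ((e(i := x)) j)) = g i x + (\<Sum>j\<in>A - {i}. g j ((e(i := x)) j))"
    using assms by (subst sum.remove[of _ i]) auto
  also have "(\<Sum>j\<in>A - {i}. g j ((e(i := x)) j)) = (\<Sum>j\<in>A - {i}. g j (e j))"
    by (intro sum.cong) auto
  also have "\<dots> = (\<Sum>j\<in>A. g j (e j)) - g i (e i)"
    using assms by (simp add: sum_diff1)
  finally show ?thesis by simp
qed

lemma sum_fun_upd_diff:
  fixes e :: "nat \<Rightarrow> nat"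
  assumes "i \<in> {1..k}" "x \<le> e i"
  shows "(\<Sum>j=1..k. (e(i := e i - x)) j) + x = (\<Sum>j=1..k. e j)"
proof -
  have "(\<Sum>j=1..k. e j) = e i + (\<Sum>j\<in>{1..k} - {i}. e j)"
    using assms by (intro sum.remove) auto
  moreover have "(\<Sum>j=1..k. (e(i := e i - x)) j) = (e i - x) + (\<Sum>j\<in>{1..k} - {i}. e j)"
    using assms by (subst sum.remove[of _ i]) auto
  ultimately show ?thesis using assms by simp
qed

lemma surplus_star:
  assumes "i \<in> {1..k}" "s \<le> e i" "e i < m"
  shows "surplus k m s (e(i := e i - s)) = surplus k m (Suc s) e"
  unfolding surplus_def using assms
  by (subst sum_fun_upd[where g = "\<lambda>j y. if y < m then real y else 0"])
     (auto simp: numeral_2_eq_2 of_nat_diff)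

text \<open>The number of edges falls by \<open>(a choose 2) + a * r\<close>, which is at most
  \<open>m\<close>. The edges held by colours below \<open>m\<close> increase only if colour
  \<open>i\<close> drops below \<open>m\<close>, and then by less than \<open>m\<close>.\<close>

lemma surplus_block:
  assumes "i \<in> {1..k}" "m \<le> e i" "a * (r + a) \<le> m"
  shows "surplus k m (r + a) e - 2 * real m \<le> surplus k m r (e(i := e i - a * r))"
proof -
  have "real (a choose 2) + real (a * r) \<le> real m"
  proof -
    have "(a choose 2) \<le> a * a"
      by (metis binomial_le_pow2 choose_two div_le_dividend le_trans diff_le_self mult_le_mono2)
    with assms(3) have "(a choose 2) + a * r \<le> m" by (simp add: algebra_simps)
    then show ?thesis by (metis of_nat_add of_nat_mono)
  qed
  then show ?thesis
    unfolding surplus_def using assms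
    by (subst sum_fun_upd[where g = "\<lambda>j y. if y < m then real y else 0"])
       (auto simp: choose_two_add)
qed

text \<open>A discrete derivative of the logarithm. As \<open>D\<close> is at least
  \<open>4 * m\<close>, a loss of \<open>2 * m\<close> at most halves it, so \<open>2 * m\<close>
  divided by the new value is at most \<open>4 * m / D\<close>. Below \<open>D1\<close> the
  logarithm is cut off at 0.\<close>

lemma ln_max_step:
  fixes m D D' D1 :: real
  assumes "0 < m" "4 * m \<le> D1" "D1 \<le> D" "D - 2 * m \<le> D'"
  shows "ln (max D D1 / D1) - ln (max D' D1 / D1) \<le> 4 * m / D"
proof -
  define D'' where "D'' = max D' D1"
  have pos: "D1 > 0" "D > 0" "D'' > 0" using assms by (auto simp: D''_def)
  have half: "D / 2 \<le> D''" using assms by (auto simp: D''_def)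
  have "ln (max D D1 / D1) - ln (D'' / D1) = ln (D / D'')"
    using assms pos by (simp add: max_def ln_div)
  also have "\<dots> \<le> D / D'' - 1" using pos by (intro ln_le_minus_one) simp
  also have "\<dots> = (D - D'') / D''" using pos by (simp add: field_simps)
  also have "\<dots> \<le> 2 * m / D''"
    using assms pos by (intro divide_right_mono) (auto simp: D''_def)
  also have "\<dots> \<le> 2 * m / (D / 2)"
    using assms pos half by (intro divide_left_mono) auto
  finally show ?thesis by (simp add: D''_def)
qed

text \<open>Induction on \<open>s\<close>, adding blocks while the surplus is at least
  \<open>D1\<close>. The final packing needs both gains, in capacity and in number of blocks, and it
  needs block sizes in the range \<open>adm\<close>. Here \<open>D1m\<close> limits the relative
  loss per block, \<open>D1k\<close> keeps \<open>s\<close> above \<open>4 * k\<close>, and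
  \<open>D1a\<close> yields the upper bound in \<open>adm\<close>.\<close>

lemma descent:
  fixes k m n s :: nat and D1 :: real
  defines "adm \<equiv> \<lambda>a. m div n \<le> a \<and> a\<^sup>2 \<le> 2 * k * (m div n)"
  assumes n: "0 < n" and mn: "2 * n \<le> m" and D1m: "4 * real m \<le> D1"
    and D1k: "8 * (real k + 1)\<^sup>2 \<le> D1" and D1a: "(real m)\<^sup>2 \<le> 4 * real k * real (m div n) * D1"
    and "s \<le> n" and "(\<Sum>i=1..k. e i) = (s choose 2) + capacity B" and "\<forall>a\<in>#B. adm a"
  shows "\<exists>s' e' B'. (realises k s' e' (items B') \<longrightarrow> realises k s e (items B)) \<and>
     (\<Sum>i=1..k. e' i) = (s' choose 2) + capacity B' \<and> (\<forall>a\<in>#B'. adm a) \<and>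
     real (capacity B) + real m / 512 * ln (max (surplus k m s e) D1 / D1) \<le> real (capacity B') \<and>
     real (size B) + (surplus k m s e - D1) / (2 * real m) \<le> real (size B')"
  using assms(7-)
proof (induction s arbitrary: e B rule: less_induct)
  case (less s)
  have m: "0 < m" using n mn by simp
  have D1: "0 < D1" using m D1m by simp
  show ?case
  proof (cases "surplus k m s e < D1")
    \<comment> \<open>Stop here: both promised gains are at most 0.\<close>
    case True
    then have "ln (max (surplus k m s e) D1 / D1) = 0" using D1 by (simp add: max_def)
    moreover have "(surplus k m s e - D1) / (2 * real m) \<le> 0"
      using True m by (simp add: divide_nonpos_pos)
    ultimately show ?thesis
      using less.prems by (intro exI[of _ s] exI[of _ e] exI[of _ B]) simp
  next
    case False
    define D where "D = surplus k m s e"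
    have DD1: "D1 \<le> D" using False by (simp add: D_def)
    have DE: "D \<le> real (s choose 2)"
      unfolding D_def surplus_def by (simp add: sum_nonneg)
    have s2: "2 * D1 \<le> (real s)\<^sup>2"
    proof -
      have "2 * D1 \<le> real s * (real s - 1)" using DD1 DE by (simp add: real_choose_two)
      also have "\<dots> \<le> (real s)\<^sup>2" by (simp add: power2_eq_square algebra_simps)
      finally show ?thesis .
    qed
    have s4k: "4 * k + 4 \<le> s"
    proof -
      have "(4 * (real k + 1))\<^sup>2 = 16 * (real k + 1)\<^sup>2" by (simp only: power_mult_distrib) simp
      then have "(4 * (real k + 1))\<^sup>2 \<le> (real s)\<^sup>2" using s2 D1k by linarith
      then have "4 * (real k + 1) \<le> real s" by (rule power2_le_imp_le) simp
      then have "real (4 * k + 4) \<le> real s" by simp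
      then show ?thesis by (simp only: of_nat_le_iff)
    qed
    show ?thesis
    proof (cases "\<exists>i\<in>{1..k}. s - 1 \<le> e i \<and> e i < m")
      \<comment> \<open>A colour that can afford a single vertex but is already below
        \<open>m\<close> is spent on one; surplus and blocks stay as they are.\<close>
      case True
      then obtain i where i: "i \<in> {1..k}" "s - 1 \<le> e i" "e i < m" by blast
      define r where "r = s - 1"
      have r: "s = Suc r" using s4k by (simp add: r_def)
      define e1 where "e1 = e(i := e i - r)"
      have sum1: "(\<Sum>j=1..k. e1 j) = (r choose 2) + capacity B"
      proof -
        have "(\<Sum>j=1..k. e1 j) + r = (\<Sum>j=1..k. e j)"
          unfolding e1_def using i r by (intro sum_fun_upd_diff) auto
        then show ?thesis using less.prems(2) r by (simp add: numeral_2_eq_2)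
      qed
      have re: "realises k r e1 (items B) \<longrightarrow> realises k s e (items B)"
        using realises_block[of i k 1 r e "items B"] i r by (auto simp: e1_def)
      have su: "surplus k m r e1 = surplus k m s e"
        unfolding e1_def r using surplus_star[of i k r e m] i r by simp
      have "\<exists>s' e' B'. (realises k s' e' (items B') \<longrightarrow> realises k r e1 (items B)) \<and>
     (\<Sum>i=1..k. e' i) = (s' choose 2) + capacity B' \<and> (\<forall>a\<in>#B'. adm a) \<and>
     real (capacity B) + real m / 512 * ln (max (surplus k m r e1) D1 / D1) \<le> real (capacity B') \<and>
     real (size B) + (surplus k m r e1 - D1) / (2 * real m) \<le> real (size B')"
        using less.IH[of r e1 B] r less.prems sum1 by simp
      then show ?thesis unfolding su using re by blast
    next
      \<comment> \<open>Now every colour below \<open>m\<close> has fewer than \<open>s - 1\<close>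
        edges. Together they hold at most \<open>k * s\<close> edges, at most half of
        \<open>s choose 2\<close>, so the surplus \<open>D\<close> is at least the other
        half.\<close>
      case none: False
      have small: "e i \<le> s - 2" if "i \<in> {1..k}" "e i < m" for i
      proof -
        have "\<not> s - 1 \<le> e i" using none that by blast
        then show ?thesis by linarith
      qed
      have sumle: "(\<Sum>i=1..k. if e i < m then real (e i) else 0) \<le> real k * real s"
      proof -
        have "(\<Sum>i=1..k. if e i < m then real (e i) else 0) \<le> (\<Sum>i=1..k. real s)"
        proof (rule sum_mono)
          fix i assume "i \<in> {1..k}"
          then show "(if e i < m then real (e i) else 0) \<le> real s" using small[of i] by auto
        qed
        then show ?thesis by simp
      qed
      have ks: "real k * real s \<le> real (s choose 2) / 2"
      proof -
        have "4 * (real k * real s) \<le> (real s - 1) * real s"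
          using s4k by (subst mult.assoc[symmetric], intro mult_right_mono) auto
        then show ?thesis by (simp add: real_choose_two mult.commute)
      qed
      have E2D: "real (s choose 2) \<le> 2 * D"
      proof -
        have "E \<le> 2 * (E - t)" if "t \<le> q" "q \<le> E / 2" for E t q :: real using that by simp
        from this[OF sumle ks] show ?thesis unfolding D_def surplus_def .
      qed
      \<comment> \<open>If all colours were below \<open>m\<close>, they would hold at least
        \<open>s choose 2\<close> edges and the surplus could not be positive.\<close>
      obtain i where i: "i \<in> {1..k}" "m \<le> e i"
      proof -
        have "\<exists>i\<in>{1..k}. m \<le> e i"
        proof (rule ccontr)
          assume "\<not> ?thesis"
          then have "e i < m" if "i \<in> {1..k}" for i using that by (meson not_le)
          then have "(\<Sum>i=1..k. if e i < m then real (e i) else 0) = real (\<Sum>i=1..k. e i)"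
            by (simp add: of_nat_sum)
          also have "\<dots> \<ge> real (s choose 2)" using less.prems(2) by simp
          finally have "D \<le> 0" unfolding D_def surplus_def by simp
          then show False using DD1 D1 by simp
        qed
        then show ?thesis using that by blast
      qed
      \<comment> \<open>The largest block whose edges to the rest, even when counted as
        \<open>a * s\<close>, cost at most \<open>m\<close>.\<close>
      define a where "a = m div s"
      have as: "a * s \<le> m" by (simp add: a_def)
      have s0: "0 < s" using s4k by simp
      have a2: "2 \<le> a"
      proof -
        have "2 * s \<le> m" using mn less.prems(1) by simp
        then show ?thesis using s0 by (simp add: a_def less_eq_div_iff_mult_less_eq)
      qed
      have aAdm: "adm a"
      proof -
        have "m div n \<le> a" unfolding a_def using less.prems(1) s0 by (rule div_le_mono2[rotated])
        moreover have "a\<^sup>2 \<le> 2 * k * (m div n)"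
        proof -
          \<comment> \<open>Besides \<open>a * s \<le> m\<close>, the bounds \<open>D1a\<close> and
            \<open>2 * D1 \<le> s\<^sup>2\<close> give
            \<open>m\<^sup>2 \<le> 2 * k * (m div n) * s\<^sup>2\<close>.\<close>
          have "real a * real s \<le> real m" using as by (metis of_nat_le_iff of_nat_mult)
          then have "(real a * real s)\<^sup>2 \<le> (real m)\<^sup>2" by (intro power_mono) auto
          also have "\<dots> \<le> 4 * real k * real (m div n) * D1" by (rule D1a)
          also have "\<dots> \<le> (2 * real k * real (m div n)) * (real s)\<^sup>2"
            using mult_left_mono[OF s2, of "2 * real k * real (m div n)"] by (simp add: algebra_simps)
          finally have "(real a)\<^sup>2 * (real s)\<^sup>2 \<le> (2 * real k * real (m div n)) * (real s)\<^sup>2"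
            by (simp add: power_mult_distrib)
          then have "(real a)\<^sup>2 \<le> 2 * real k * real (m div n)"
            using s0 by (subst (asm) mult_le_cancel_right) auto
          then have "real (a\<^sup>2) \<le> real (2 * k * (m div n))" by simp
          then show ?thesis by (simp only: of_nat_le_iff)
        qed
        ultimately show ?thesis by (simp add: adm_def)
      qed
      have a_s: "a \<le> s"
      proof -
        have "real a * real s \<le> real m" using as by (metis of_nat_le_iff of_nat_mult)
        also have "\<dots> \<le> (real s)\<^sup>2" using s2 D1m m by linarith
        finally have "real a \<le> real s" using s0 by (simp add: power2_eq_square)
        then show ?thesis by simp
      qed
      define r where "r = s - a"
      have r: "s = r + a" "r < s" using a_s a2 by (auto simp: r_def)
      define e1 where "e1 = e(i := e i - a * r)"
      have ar: "a * r \<le> e i"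
      proof -
        have "a * r \<le> a * s" using r by simp
        then show ?thesis using as i by linarith
      qed
      have sum1: "(\<Sum>j=1..k. e1 j) = (r choose 2) + capacity (add_mset a B)"
      proof -
        have "(\<Sum>j=1..k. e1 j) + a * r = (\<Sum>j=1..k. e j)"
          unfolding e1_def using i ar by (intro sum_fun_upd_diff) auto
        then show ?thesis using less.prems(2) r(1) by (simp add: choose_two_add)
      qed
      have re: "realises k r e1 (items (add_mset a B)) \<longrightarrow> realises k s e (items B)"
        using realises_block[of i k a r e "items B"] i ar r(1) by (auto simp: e1_def)
      define D' where "D' = surplus k m r e1"
      have D': "D - 2 * real m \<le> D'"
        unfolding D_def D'_def e1_def r(1) using i as r(1) by (intro surplus_block) auto
      from less.IH[of r e1 "add_mset a B"] r less.prems sum1 aAdm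
      obtain s' e' B' where IH: "realises k s' e' (items B') \<longrightarrow> realises k r e1 (items (add_mset a B))"
        "(\<Sum>i=1..k. e' i) = (s' choose 2) + capacity B'" "\<forall>a\<in>#B'. adm a"
        "real (capacity (add_mset a B)) + real m / 512 * ln (max D' D1 / D1) \<le> real (capacity B')"
        "real (size (add_mset a B)) + (D' - D1) / (2 * real m) \<le> real (size B')"
        unfolding D'_def by auto
      \<comment> \<open>Origin of 512: the logarithm drops by at most \<open>4 * m / D\<close> and
        \<open>s\<^sup>2 \<le> 8 * D\<close>, so the left side is at most
        \<open>(m / (2 * s))\<^sup>2 / 4\<close>. Rounding down at most halves \<open>m / s\<close>,
        and \<open>a\<^sup>2 / 4\<close> is at most \<open>a choose 2\<close> because
        \<open>a\<close> is at least 2.\<close>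
      have "real m / 512 * (ln (max D D1 / D1) - ln (max D' D1 / D1)) \<le> real (a choose 2)"
      proof -
        have "real m / 512 * (ln (max D D1 / D1) - ln (max D' D1 / D1)) \<le> real m / 512 * (4 * real m / D)"
          using m D1m DD1 D' by (intro mult_left_mono ln_max_step) auto
        also have "\<dots> = (real m)\<^sup>2 / (128 * D)" by (simp add: power2_eq_square)
        also have "\<dots> \<le> (real m)\<^sup>2 / (16 * (real s)\<^sup>2)"
        proof -
          have "(real s)\<^sup>2 \<le> 2 * (real s * (real s - 1))"
            using s4k by (simp add: power2_eq_square algebra_simps)
          then have "(real s)\<^sup>2 \<le> 8 * D" using E2D by (simp add: real_choose_two)
          then show ?thesis using s0 DD1 D1 by (intro divide_left_mono) auto
        qed
        also have "\<dots> = (real m / (2 * real s))\<^sup>2 / 4" by (simp add: power_divide power_mult_distrib)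
        also have "\<dots> \<le> (real a)\<^sup>2 / 4"
        proof -
          have "m < (a + 1) * s" unfolding a_def using s0
            by (metis Suc_eq_plus1 dividend_less_div_times mult_Suc add.commute)
          also have "\<dots> \<le> (2 * a) * s" using a2 by (intro mult_right_mono) auto
          finally have "real m \<le> real (2 * a * s)" by (simp only: of_nat_le_iff less_imp_le)
          then have "real m / (2 * real s) \<le> real a" using s0 by (simp add: field_simps)
          then show ?thesis by (intro divide_right_mono power_mono) auto
        qed
        also have "\<dots> \<le> real (a choose 2)"
          using a2 by (simp add: real_choose_two power2_eq_square field_simps)
        finally show ?thesis .
      qed
      then have c: "real (capacity B) + real m / 512 * ln (max D D1 / D1) \<le> real (capacity B')"
        using IH(4) by (simp add: algebra_simps)
      have "(D - D1) / (2 * real m) \<le> 1 + (D' - D1) / (2 * real m)"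
        using D' m by (simp add: field_simps)
      then have "real (size B) + (D - D1) / (2 * real m) \<le> real (size B')"
        using IH(5) by simp
      then show ?thesis using c IH(1-3) re unfolding D_def by blast
    qed
  qed
qed

section \<open>The final greedy packing\<close>

lemma filter_less_star: "sum_mset (filter_mset (\<lambda>y. y < x) (mset_set {1..<a})) = min a x choose 2"
proof -
  have "filter_mset (\<lambda>y. y < x) (mset_set {1..<a}) = mset_set {1..<min a x}"
    by (subst filter_mset_mset_set) (auto intro!: arg_cong[of _ _ mset_set])
  then show ?thesis
    using sum_atLeast1_lessThan[of "min a x"] by (simp add: sum_unfold_sum_mset)
qed

lemma filter_less_items:
  "sum_mset (filter_mset (\<lambda>y. y < x) (items B)) = (\<Sum>a\<in>#B. min a x choose 2)"
  by (induction B) (simp_all add: filter_less_star[simplified])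

lemma set_items: "x \<in># items B \<Longrightarrow> \<exists>a\<in>#B. 1 \<le> x \<and> x < a"
  by (induction B) auto

lemma two_choose_two_le_square: "2 * (a choose 2) \<le> a\<^sup>2"
proof -
  have "real (2 * (a choose 2)) \<le> real (a\<^sup>2)"
    by (simp add: real_choose_two power2_eq_square algebra_simps)
  then show ?thesis by (simp only: of_nat_le_iff)
qed

lemma two_choose_two: "2 * (x choose 2) = x * (x - 1)"
  by (cases x) (auto simp: choose_two)

text \<open>The greedy condition is checked for each star size \<open>x\<close>: sizes up to
  \<open>A\<close> are covered by the number of blocks, sizes from there to \<open>2 * k\<close> by
  their capacity, and larger ones by the remaining \<open>s\<close> vertices alone.\<close>

lemma realises_if_capacity:
  fixes k s A :: nat
  assumes k: "1 \<le> k" and A: "A \<le> 2 * k" and adm: "\<forall>a\<in>#B. A \<le> a \<and> a\<^sup>2 \<le> 2 * k * A"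
    and size: "k \<le> size B" and cap: "2 * k\<^sup>2 \<le> capacity B"
    and sum: "(\<Sum>i=1..k. e i) = (s choose 2) + capacity B"
  shows "realises k s e (items B)"
proof (rule realises_packs[OF packs_greedy k])
  let ?N = "items B + mset_set {1..<s}"
  show "(\<Sum>i=1..k. e i) = sum_mset ?N"
    using sum sum_atLeast1_lessThan[of s] by (simp add: sum_mset_items sum_unfold_sum_mset)
  show "\<forall>x\<in>#?N. 1 \<le> x" using set_items by auto
  show "\<forall>x\<in>#?N. k * (x - 1) \<le> sum_mset (filter_mset (\<lambda>y. y < x) ?N)"
  proof
    fix x assume x: "x \<in># ?N"
    define T where "T = (\<Sum>a\<in>#B. min a x choose 2)"
    have eq: "sum_mset (filter_mset (\<lambda>y. y < x) ?N) = T + (min s x choose 2)"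
      using filter_less_items[of x B] filter_less_star[of x s] by (simp add: T_def)
    have x1: "1 \<le> x" using x set_items by auto
    show "k * (x - 1) \<le> sum_mset (filter_mset (\<lambda>y. y < x) ?N)"
    proof (cases "x \<le> 2 * k")
      \<comment> \<open>All removed blocks have at most \<open>2 * k\<close> vertices, so
        \<open>x\<close> is a star among the last \<open>s\<close> vertices, where the smaller stars
        already total \<open>x choose 2\<close>.\<close>
      case False
      have "x < s"
      proof (rule ccontr)
        assume "\<not> x < s"
        with x have "x \<in># items B" by auto
        then obtain a where a: "a \<in># B" "x < a" using set_items by blast
        have "a\<^sup>2 \<le> 2 * k * A" using adm a by blast
        also have "\<dots> \<le> 2 * k * (2 * k)" using A by simp
        finally have "a\<^sup>2 \<le> (2 * k)\<^sup>2" by (simp add: power2_eq_square)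
        then have "a \<le> 2 * k" by (rule power2_le_imp_le) simp
        then show False using a False by simp
      qed
      have "2 * (k * (x - 1)) \<le> x * (x - 1)"
        using False by (subst mult.assoc[symmetric], intro mult_right_mono) auto
      also have "\<dots> = 2 * (x choose 2)" by (simp add: two_choose_two)
      finally have "k * (x - 1) \<le> x choose 2" by simp
      then show ?thesis unfolding eq using \<open>x < s\<close> by simp
    next
      case x2k: True
      have "k * (x - 1) \<le> T"
      proof (cases "x \<le> A")
        case True
        \<comment> \<open>Each of the at least \<open>k\<close> blocks contains all stars below
          \<open>x\<close>.\<close>
        have "k * (x - 1) \<le> k * (x choose 2)"
        proof -
          have "2 * (x - 1) \<le> x * (x - 1)" using x1 by (cases "x = 1") (auto intro!: mult_right_mono)
          then have "x - 1 \<le> x choose 2" using two_choose_two[of x] by linarith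
          then show ?thesis by simp
        qed
        also have "\<dots> \<le> size B * (x choose 2)" using size by simp
        also have "\<dots> = (\<Sum>a\<in>#B. x choose 2)" by simp
        also have "\<dots> = T"
          unfolding T_def
        proof (intro arg_cong[of _ _ sum_mset] image_mset_cong)
          fix a assume "a \<in># B"
          then have "x \<le> a" using adm True le_trans by blast
          then show "x choose 2 = min a x choose 2" by simp
        qed
        finally show ?thesis .
      next
        case False
        \<comment> \<open>Below \<open>x\<close> a block offers at least the fraction
          \<open>(x - 1) / (2 * k)\<close> of its edges: all of them if \<open>a \<le> x\<close>,
          and otherwise \<open>x choose 2\<close>, to be compared with
          \<open>(a choose 2) \<le> k * A \<le> k * x\<close>.\<close>
        have each: "(a choose 2) * (x - 1) \<le> (min a x choose 2) * (2 * k)" if a: "a \<in># B" for a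
        proof (cases "a \<le> x")
          case True
          then show ?thesis using x2k by (auto intro!: mult_left_mono)
        next
          case ax: False
          have "2 * (a choose 2) \<le> a\<^sup>2" by (rule two_choose_two_le_square)
          also have "\<dots> \<le> 2 * k * A" using adm a by blast
          finally have "(a choose 2) \<le> k * A" by simp
          also have "\<dots> \<le> k * x" using False by simp
          finally have "(a choose 2) * (x - 1) \<le> k * x * (x - 1)" by (rule mult_right_mono) simp
          also have "\<dots> = k * (2 * (x choose 2))" by (simp add: two_choose_two)
          finally show ?thesis using ax by (simp add: min_def mult.commute mult.left_commute)
        qed
        have "2 * k * (k * (x - 1)) = 2 * k\<^sup>2 * (x - 1)" by (simp add: power2_eq_square)
        also have "\<dots> \<le> capacity B * (x - 1)" using cap by (rule mult_right_mono) simp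
        also have "\<dots> = (\<Sum>a\<in>#B. (a choose 2) * (x - 1))"
          by (simp add: capacity_def sum_mset_distrib_right)
        also have "\<dots> \<le> (\<Sum>a\<in>#B. (min a x choose 2) * (2 * k))"
          using each by (rule sum_mset_mono)
        also have "\<dots> = 2 * k * T" unfolding T_def sum_mset_distrib_right[symmetric] by simp
        finally show ?thesis using k by simp
      qed
      then show ?thesis unfolding eq by simp
    qed
  qed
qed

section \<open>The upper bound\<close>

text \<open>Where the conditions on \<open>n\<close> enter: \<open>n64\<close> gives
  \<open>2 * n \<le> m\<close> and \<open>4 * m \<le> D1\<close>, \<open>n4\<close> gives
  \<open>A \<le> 2 * k\<close> and \<open>D1 \<le> n\<^sup>2 / 8\<close>, \<open>n3\<close> gives
  \<open>8 * (k + 1)\<^sup>2 \<le> D1\<close>, \<open>n7\<close> makes the logarithm gained at least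
  \<open>ln k / 4\<close>, and \<open>nl\<close> lifts the capacity to
  \<open>2 * k\<^sup>2\<close>.\<close>

lemma realises_all:
  fixes k n :: nat
  assumes k: "2 \<le> k" and n64: "64 * k \<le> n" and n4: "n \<le> 4 * k\<^sup>2"
    and n3: "2048 * real k ^ 4 \<le> real n ^ 3" and n7: "real n ^ 4 \<le> 4096 * real k ^ 7"
    and nl: "131072 * real k ^ 3 \<le> (real n)\<^sup>2 * ln (real k)"
    and sum: "(\<Sum>i=1..k. e i) = n choose 2"
  shows "realises k n e {#}"
proof -
  \<comment> \<open>Colours below \<open>m\<close> then hold at most \<open>n\<^sup>2 / 16\<close>
    edges, so the surplus starts at no less than \<open>n\<^sup>2 / 4\<close>.\<close>
  define m where "m = n\<^sup>2 div (16 * k)"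
  define A where "A = m div n"
  \<comment> \<open>Since \<open>m \<le> 2 * n * A\<close>, this is just enough for
    \<open>m\<^sup>2 \<le> 4 * k * A * D1\<close>.\<close>
  define D1 where "D1 = real m * real n / (2 * real k)"
  define N K where "N = real n" and "K = real k"
  have K: "2 \<le> K" and NK: "64 * K \<le> N" and N4: "N \<le> 4 * K\<^sup>2"
  proof -
    show "2 \<le> K" using k by (simp add: K_def)
    show "64 * K \<le> N" using n64 unfolding K_def N_def by linarith
    show "N \<le> 4 * K\<^sup>2" using n4 unfolding K_def N_def
      by (metis of_nat_le_iff of_nat_mult of_nat_numeral of_nat_power)
  qed
  have pos: "0 < K" "0 < N" "0 < k" "0 < n" using K NK k n64 by auto
  have mu: "real m \<le> N\<^sup>2 / (16 * K)"
    unfolding m_def N_def K_def using of_nat_div_le_of_nat[of "n\<^sup>2" "16 * k", where 'a = real] by simp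
  have ml: "N\<^sup>2 / (32 * K) \<le> real m"
  proof -
    have "real_of_int \<lfloor>real (n\<^sup>2) / real (16 * k)\<rfloor> = real m"
      by (simp only: floor_divide_of_nat_eq m_def of_int_of_nat_eq)
    then have "real (n\<^sup>2) / real (16 * k) - 1 \<le> real m" by linarith
    then have "N\<^sup>2 / (16 * K) - 1 \<le> real m" by (simp add: N_def K_def)
    moreover have "1 \<le> N\<^sup>2 / (32 * K)"
    proof -
      have "32 * K * 1 \<le> N * N" using NK K by (intro mult_mono) auto
      then show ?thesis using pos by (simp add: power2_eq_square)
    qed
    moreover have "N\<^sup>2 / (16 * K) = N\<^sup>2 / (32 * K) + N\<^sup>2 / (32 * K)" by (simp add: field_simps)
    ultimately show ?thesis by linarith
  qed
  have mn: "2 * n \<le> m"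
  proof -
    have "2 * N \<le> N\<^sup>2 / (32 * K)" using NK pos by (simp add: power2_eq_square field_simps)
    then have "real (2 * n) \<le> real m" using ml by (simp add: N_def)
    then show ?thesis by (simp only: of_nat_le_iff)
  qed
  have m0: "0 < m" using mn pos by simp
  have Al: "real m \<le> 2 * N * real A"
  proof -
    have A1: "1 \<le> A" unfolding A_def using mn pos by (simp add: less_eq_div_iff_mult_less_eq)
    have "m < (A + 1) * n" unfolding A_def using pos
      by (metis Suc_eq_plus1 dividend_less_div_times mult_Suc add.commute)
    also have "\<dots> \<le> (2 * A) * n" using A1 by (intro mult_right_mono) auto
    finally have "real m \<le> real (2 * A * n)" by (simp only: of_nat_le_iff less_imp_le)
    then show ?thesis by (simp add: N_def mult_ac)
  qed
  have Au: "A \<le> 2 * k"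
  proof -
    have "real A \<le> real m / N" unfolding A_def N_def by (rule of_nat_div_le_of_nat)
    also have "\<dots> \<le> (N\<^sup>2 / (16 * K)) / N" using mu pos by (intro divide_right_mono) auto
    also have "\<dots> = N / (16 * K)" using pos by (simp add: power2_eq_square)
    also have "\<dots> \<le> 4 * K\<^sup>2 / (16 * K)" using N4 pos by (intro divide_right_mono) auto
    also have "\<dots> \<le> 2 * K" using pos by (simp add: power2_eq_square)
    finally have "real A \<le> real (2 * k)" by (simp add: K_def)
    then show ?thesis by (simp only: of_nat_le_iff)
  qed
  have D1N: "D1 = real m * N / (2 * K)" by (simp add: D1_def N_def K_def)
  have D1u: "D1 \<le> N\<^sup>2 / 8"
  proof -
    have "D1 \<le> (N\<^sup>2 / (16 * K)) * N / (2 * K)"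
      unfolding D1N using mu pos by (intro divide_right_mono mult_right_mono) auto
    also have "\<dots> = N\<^sup>2 * N / (32 * K\<^sup>2)" by (simp add: power2_eq_square)
    also have "\<dots> \<le> N\<^sup>2 * (4 * K\<^sup>2) / (32 * K\<^sup>2)"
      using N4 by (intro divide_right_mono mult_left_mono) auto
    also have "\<dots> = N\<^sup>2 / 8" using pos by simp
    finally show ?thesis .
  qed
  have c1: "4 * real m \<le> D1"
  proof -
    have "real m * (8 * K) \<le> real m * N" using NK pos by (intro mult_left_mono) auto
    then show ?thesis unfolding D1N using pos by (simp add: field_simps)
  qed
  have c2: "8 * (real k + 1)\<^sup>2 \<le> D1"
  proof -
    have "(K + 1)\<^sup>2 \<le> (2 * K)\<^sup>2" using K by (intro power_mono) auto
    then have "8 * (K + 1)\<^sup>2 \<le> 32 * K\<^sup>2" by simp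
    also have "\<dots> = (2048 * K ^ 4) / (64 * K\<^sup>2)" using pos by (simp add: power_def numeral_eq_Suc)
    also have "\<dots> \<le> N ^ 3 / (64 * K\<^sup>2)"
      using n3 by (intro divide_right_mono) (auto simp: N_def K_def)
    also have "\<dots> = (N\<^sup>2 / (32 * K)) * N / (2 * K)" by (simp add: power2_eq_square power3_eq_cube)
    also have "\<dots> \<le> D1"
      unfolding D1N using ml pos by (intro divide_right_mono mult_right_mono) auto
    finally show ?thesis by (simp add: K_def)
  qed
  have c3: "(real m)\<^sup>2 \<le> 4 * real k * real (m div n) * D1"
  proof -
    have "4 * K * real A * D1 = real m * (2 * N * real A)"
      unfolding D1N using pos by (simp add: field_simps)
    moreover have "(real m)\<^sup>2 \<le> real m * (2 * N * real A)"
      unfolding power2_eq_square using Al by (intro mult_left_mono) auto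
    ultimately have "(real m)\<^sup>2 \<le> 4 * K * real A * D1" by (simp only:)
    then show ?thesis unfolding A_def K_def .
  qed
  define D where "D = surplus k m n e"
  have Dl: "N\<^sup>2 / 4 \<le> D"
  proof -
    have "(\<Sum>i=1..k. if e i < m then real (e i) else 0) \<le> (\<Sum>i=1..k. real m)"
      by (rule sum_mono) auto
    also have "\<dots> = K * real m" by (simp add: K_def)
    also have "\<dots> \<le> K * (N\<^sup>2 / (16 * K))" using mu pos by (intro mult_left_mono) auto
    also have "\<dots> = N\<^sup>2 / 16" using pos by simp
    finally have "N * (N - 1) / 2 - N\<^sup>2 / 16 \<le> D"
      unfolding D_def surplus_def by (simp add: real_choose_two N_def)
    moreover have "N * 8 \<le> N * N" using NK K by (intro mult_left_mono) auto
    moreover have "N * (N - 1) = N * N - N" "0 \<le> N * N" by (simp_all add: algebra_simps)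
    ultimately show ?thesis unfolding power2_eq_square by linarith
  qed
  from descent[of n m D1 k n e "{#}", OF pos(4) mn c1 c2 c3] sum
  obtain s' e' B' where d: "realises k s' e' (items B') \<longrightarrow> realises k n e {#}"
    "(\<Sum>i=1..k. e' i) = (s' choose 2) + capacity B'"
    "\<forall>a\<in>#B'. A \<le> a \<and> a\<^sup>2 \<le> 2 * k * A"
    "real m / 512 * ln (max D D1 / D1) \<le> real (capacity B')"
    "(D - D1) / (2 * real m) \<le> real (size B')"
    unfolding D_def A_def by auto
  have D1pos: "0 < D1" using c1 m0 by linarith
  have size: "k \<le> size B'"
  proof -
    have "K * (2 * real m) \<le> K * (2 * (N\<^sup>2 / (16 * K)))" using mu pos by (intro mult_left_mono) auto
    also have "\<dots> = N\<^sup>2 / 8" using pos by simp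
    also have "\<dots> \<le> D - D1" using Dl D1u by simp
    finally have "K \<le> (D - D1) / (2 * real m)" using m0 by (simp add: field_simps)
    then show ?thesis using d(5) by (simp add: K_def)
  qed
  have cap: "2 * k\<^sup>2 \<le> capacity B'"
  proof -
    \<comment> \<open>\<open>D / D1\<close> is at least \<open>8 * K\<^sup>2 / N\<close>, whose
      fourth power is at least \<open>K\<close> by \<open>n7\<close>, as
      \<open>8 ^ 4 = 4096\<close>.\<close>
    have "ln K \<le> 4 * ln (8 * K\<^sup>2 / N)"
    proof -
      have "K * N ^ 4 \<le> K * (4096 * K ^ 7)"
        using n7 pos by (intro mult_left_mono) (auto simp: N_def K_def)
      also have "\<dots> = (8 * K\<^sup>2) ^ 4" by (simp add: power_mult_distrib numeral_eq_Suc)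
      finally have "K \<le> (8 * K\<^sup>2 / N) ^ 4" using pos by (simp add: power_divide field_simps)
      then have "ln K \<le> ln ((8 * K\<^sup>2 / N) ^ 4)" using pos by (subst ln_le_cancel_iff) auto
      also have "\<dots> = 4 * ln (8 * K\<^sup>2 / N)" using pos by (subst ln_realpow) auto
      finally show ?thesis .
    qed
    also have "\<dots> \<le> 4 * ln (max D D1 / D1)"
    proof -
      have "8 * K\<^sup>2 / N * D1 \<le> 8 * K\<^sup>2 / N * ((N\<^sup>2 / (16 * K)) * N / (2 * K))"
        unfolding D1N using mu pos by (intro mult_left_mono divide_right_mono mult_right_mono) auto
      also have "\<dots> = N\<^sup>2 / 4" using pos by (simp add: power2_eq_square field_simps)
      also have "\<dots> \<le> max D D1" using Dl by simp
      finally have "8 * K\<^sup>2 / N \<le> max D D1 / D1" using D1pos by (simp add: pos_le_divide_eq)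
      then show ?thesis using pos D1pos by simp
    qed
    finally have l: "ln K / 4 \<le> ln (max D D1 / D1)" by simp
    have lnK: "0 \<le> ln K" using K by simp
    \<comment> \<open>Here 65536 is 32 * 512 * 4: the factors come from the lower bound for
      \<open>m\<close>, from the descent and from \<open>ln K / 4\<close>.\<close>
    have "2 * K\<^sup>2 = (131072 * K ^ 3) / (65536 * K)" using pos by (simp add: numeral_eq_Suc)
    also have "\<dots> \<le> (N\<^sup>2 * ln K) / (65536 * K)"
      using nl pos by (intro divide_right_mono) (auto simp: N_def K_def)
    also have "\<dots> = (N\<^sup>2 / (32 * K)) / 512 * (ln K / 4)" by simp
    also have "\<dots> \<le> real m / 512 * ln (max D D1 / D1)"
      using ml l lnK pos by (intro mult_mono divide_right_mono) auto
    also have "\<dots> \<le> real (capacity B')" by (rule d(4))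
    finally have "real (2 * k\<^sup>2) \<le> real (capacity B')" by (simp add: K_def)
    then show ?thesis by (simp only: of_nat_le_iff)
  qed
  have "realises k s' e' (items B')"
    using k Au d(3) size cap d(2) by (intro realises_if_capacity[of k A]) auto
  with d(1) show ?thesis by blast
qed

text \<open>From \<open>2 * k\<close> vertices on, some colour always has enough edges for a full
  star at a new vertex, by the pigeonhole principle. So it suffices to treat one value of
  \<open>n\<close>.\<close>

lemma gallai_threshold_stars:
  assumes base: "\<And>e. (\<Sum>i=1..k. e i) = N choose 2 \<Longrightarrow> realises k N e {#}" and Nk: "2 * k \<le> N" and k1: "1 \<le> k"
  shows "gallai_threshold k N"
proof -
  have "realises k n e {#}" if "N \<le> n" "(\<Sum>i=1..k. e i) = n choose 2" for n e
    using that
  proof (induction n arbitrary: e rule: dec_induct)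
    case base
    then show ?case using assms(1) by blast
  next
    case (step n)
    have "\<exists>i\<in>{1..k}. n \<le> e i"
    proof (cases "n = 0")
      case True
      then show ?thesis using k1 by (intro bexI[of _ 1]) auto
    next
      case False
      show ?thesis
      proof (rule ccontr)
        assume "\<not> ?thesis"
        then have "e i \<le> n - 1" if "i \<in> {1..k}" for i
        proof -
          have "\<not> n \<le> e i" using \<open>\<not> (\<exists>i\<in>{1..k}. n \<le> e i)\<close> that by blast
          then show ?thesis by linarith
        qed
        then have "(\<Sum>i=1..k. e i) \<le> (\<Sum>i=1..k. n - 1)" by (rule sum_mono)
        then have "2 * (Suc n choose 2) \<le> 2 * k * (n - 1)" using step.prems by simp
        also have "\<dots> \<le> n * (n - 1)" using Nk step.hyps by (intro mult_right_mono) auto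
        also have "\<dots> < Suc n * n" using False by (cases n) auto
        also have "\<dots> = 2 * (Suc n choose 2)" using two_choose_two[of "Suc n"] by simp
        finally show False by simp
      qed
    qed
    then obtain i where i: "i \<in> {1..k}" "n \<le> e i" by blast
    have "(\<Sum>j=1..k. (e(i := e i - n)) j) + n = (\<Sum>j=1..k. e j)"
      using i by (intro sum_fun_upd_diff) auto
    then have "(\<Sum>j=1..k. (e(i := e i - n)) j) = n choose 2"
      using step.prems by (simp add: numeral_2_eq_2)
    then have "realises k n (e(i := e i - n)) {#}" by (rule step.IH)
    then show ?case using realises_block[of i k 1 n e "{#}"] i by simp
  qed
  then show ?thesis unfolding gallai_threshold_def using realises_emptyD by blast
qed

lemma eventually_gallai_threshold:
  "\<forall>\<^sub>F k in sequentially.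
     gallai_threshold k (nat \<lceil>512 * (real k powr (3/2) / (ln (real k)) powr (1/2))\<rceil>)"
proof -
  \<comment> \<open>With 512, \<open>(x k)\<^sup>2 * ln k\<close> is
    \<open>512\<^sup>2 * k ^ 3\<close>, twice what is required. The summand 1 in the upper estimates
    below makes room for rounding up.\<close>
  define x where "x k = 512 * (real k powr (3/2) / (ln (real k)) powr (1/2))" for k :: nat
  have ev: "\<forall>\<^sub>F k in sequentially. 64 * real k \<le> x k" "\<forall>\<^sub>F k in sequentially. x k + 1 \<le> 4 * (real k)\<^sup>2"
    "\<forall>\<^sub>F k in sequentially. 2048 * real k ^ 4 \<le> x k ^ 3"
    "\<forall>\<^sub>F k in sequentially. (x k + 1) ^ 4 \<le> 4096 * real k ^ 7"
    "\<forall>\<^sub>F k in sequentially. 131072 * real k ^ 3 \<le> (x k)\<^sup>2 * ln (real k)"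
    unfolding x_def by real_asymp+
  show ?thesis
    using ev eventually_ge_at_top[of "2 :: nat"]
  proof eventually_elim
    case (elim k)
    define n where "n = nat \<lceil>x k\<rceil>"
    have x0: "0 \<le> x k" using elim(1) by (meson dual_order.trans mult_nonneg_nonneg of_nat_0_le_iff zero_le_numeral)
    have n: "x k \<le> real n" "real n \<le> x k + 1" using x0 unfolding n_def by linarith+
    have n64: "64 * k \<le> n"
    proof -
      have "real (64 * k) \<le> real n" using elim n by simp
      then show ?thesis by (simp only: of_nat_le_iff)
    qed
    have n4: "n \<le> 4 * k\<^sup>2"
    proof -
      have "real n \<le> real (4 * k\<^sup>2)" using elim n by simp
      then show ?thesis by (simp only: of_nat_le_iff)
    qed
    have n3: "2048 * real k ^ 4 \<le> real n ^ 3"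
      using elim(3) power_mono[OF n(1) x0, of 3] by linarith
    have n7: "real n ^ 4 \<le> 4096 * real k ^ 7"
      using elim(4) power_mono[OF n(2), of 4] by simp
    have nl: "131072 * real k ^ 3 \<le> (real n)\<^sup>2 * ln (real k)"
    proof -
      have "(x k)\<^sup>2 * ln (real k) \<le> (real n)\<^sup>2 * ln (real k)"
        using n(1) x0 elim(6) by (intro mult_right_mono power_mono) auto
      then show ?thesis using elim(5) by linarith
    qed
    have "gallai_threshold k n"
      using realises_all[OF elim(6) n64 n4 n3 n7 nl] n64 elim(6) by (intro gallai_threshold_stars) auto
    then show ?case by (simp add: n_def x_def)
  qed
qed

section \<open>Two-coloured cuts of Gallai colourings\<close>

definition gallai_on :: "nat set \<Rightarrow> (nat set \<Rightarrow> nat) \<Rightarrow> bool" where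
  "gallai_on V c \<longleftrightarrow> (\<forall>x\<in>V. \<forall>y\<in>V. \<forall>z\<in>V. x \<noteq> y \<longrightarrow> y \<noteq> z \<longrightarrow> x \<noteq> z \<longrightarrow>
     c {x, y} = c {y, z} \<or> c {y, z} = c {x, z} \<or> c {x, y} = c {x, z})"

text \<open>Connectedness of the graph of colour \<open>p\<close> on \<open>V\<close>, phrased
  through cuts since this is how it gets lifted and refuted.\<close>

definition spans :: "nat set \<Rightarrow> (nat set \<Rightarrow> nat) \<Rightarrow> nat \<Rightarrow> bool" where
  "spans V c p \<longleftrightarrow> (\<forall>A\<subseteq>V. A \<noteq> {} \<longrightarrow> A \<noteq> V \<longrightarrow> (\<exists>x\<in>A. \<exists>y\<in>V - A. c {x, y} = p))"

definition colour_rel :: "nat set \<Rightarrow> (nat set \<Rightarrow> nat) \<Rightarrow> nat \<Rightarrow> (nat \<times> nat) set" where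
  "colour_rel V c p = {(x, y). x \<in> V \<and> y \<in> V \<and> x \<noteq> y \<and> c {x, y} = p}"

text \<open>The least vertex of a component serves as its name, so that contracting the components
  means passing to a subset of \<open>V\<close> with the same \<open>c\<close>.\<close>

definition component_rep :: "nat set \<Rightarrow> (nat set \<Rightarrow> nat) \<Rightarrow> nat \<Rightarrow> nat \<Rightarrow> nat" where
  "component_rep V c p x = (LEAST y. (x, y) \<in> (colour_rel V c p)\<^sup>*)"

lemma gallai_onD:
  assumes "gallai_on V c" "x \<in> V" "y \<in> V" "z \<in> V" "x \<noteq> y" "y \<noteq> z" "x \<noteq> z"
  shows "c {x, y} = c {y, z} \<or> c {y, z} = c {x, z} \<or> c {x, y} = c {x, z}"
  using assms unfolding gallai_on_def by blast

lemma gallai_on_subset: "gallai_on V c \<Longrightarrow> W \<subseteq> V \<Longrightarrow> gallai_on W c"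
  unfolding gallai_on_def by blast

lemma spansD:
  assumes "spans V c p" "A \<subseteq> V" "A \<noteq> {}" "A \<noteq> V"
  obtains x y where "x \<in> A" "y \<in> V" "y \<notin> A" "c {x, y} = p"
  using assms unfolding spans_def by blast

lemma component_rep_rel: "(x, component_rep V c p x) \<in> (colour_rel V c p)\<^sup>*"
  unfolding component_rep_def by (rule LeastI[of _ x]) simp

lemma sym_colour_rel: "sym ((colour_rel V c p)\<^sup>*)"
  by (rule sym_rtrancl) (auto simp: sym_def colour_rel_def insert_commute)

lemma component_rep_eq:
  assumes "(x, y) \<in> (colour_rel V c p)\<^sup>*"
  shows "component_rep V c p x = component_rep V c p y"
proof -
  have "(y, x) \<in> (colour_rel V c p)\<^sup>*" using assms sym_colour_rel by (meson symD)
  with assms have "(x, z) \<in> (colour_rel V c p)\<^sup>* \<longleftrightarrow> (y, z) \<in> (colour_rel V c p)\<^sup>*" for z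
    by (meson rtrancl_trans)
  then show ?thesis unfolding component_rep_def by simp
qed

lemma component_rep_edge:
  assumes "x \<in> V" "y \<in> V" "x \<noteq> y" "c {x, y} = p"
  shows "component_rep V c p x = component_rep V c p y"
  using assms by (intro component_rep_eq r_into_rtrancl) (auto simp: colour_rel_def)

lemma component_rep_idem: "component_rep V c p (component_rep V c p x) = component_rep V c p x"
  using component_rep_eq[OF component_rep_rel] by metis

lemma component_rep_in:
  assumes "x \<in> V"
  shows "component_rep V c p x \<in> V"
proof -
  have "y \<in> V" if "(x, y) \<in> (colour_rel V c p)\<^sup>*" for y
    using that by induction (use assms in \<open>auto simp: colour_rel_def\<close>)
  then show ?thesis using component_rep_rel by blast
qed

text \<open>For an edge \<open>{y, z}\<close> of colour \<open>p\<close> in the component, neither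
  \<open>{v, y}\<close> nor \<open>{v, z}\<close> has colour \<open>p\<close>, so the triangle
  forces these two to agree. Walking along a path of colour \<open>p\<close> gives the
  claim.\<close>

lemma colour_constant_on_component:
  assumes g: "gallai_on V c" and "v \<in> V" "x \<in> V" and "(x, y) \<in> (colour_rel V c p)\<^sup>*"
    and "component_rep V c p v \<noteq> component_rep V c p x"
  shows "c {v, x} = c {v, y}"
  using assms(4)
proof induction
  case (step y z)
  have yz: "y \<in> V" "z \<in> V" "y \<noteq> z" "c {y, z} = p" using step.hyps by (auto simp: colour_rel_def)
  have r: "component_rep V c p x = component_rep V c p y" using step.hyps component_rep_eq by blast
  moreover have "component_rep V c p y = component_rep V c p z" using yz by (rule component_rep_edge)
  ultimately have ne: "v \<noteq> y" "v \<noteq> z" "c {v, y} \<noteq> p" "c {v, z} \<noteq> p"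
    using assms(5) component_rep_edge[of v V y c p] component_rep_edge[of v V z c p] assms(2) yz by auto
  have "c {v, y} = c {v, z}"
    using gallai_onD[OF g assms(2) yz(1,2) ne(1) yz(3) ne(2)] ne yz(4) by auto
  with step.IH show ?case by simp
qed simp

lemma colour_between_components:
  assumes g: "gallai_on V c" and "x \<in> V" "y \<in> V" "component_rep V c p x \<noteq> component_rep V c p y"
  shows "c {x, y} = c {component_rep V c p x, component_rep V c p y}"
proof -
  let ?r = "component_rep V c p"
  have "c {x, y} = c {x, ?r y}"
    using assms by (intro colour_constant_on_component[OF g _ _ component_rep_rel]) auto
  also have "\<dots> = c {?r y, x}" by (simp add: insert_commute)
  also have "\<dots> = c {?r y, ?r x}"
    using assms by (intro colour_constant_on_component[OF g _ _ component_rep_rel])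
      (auto simp: component_rep_in component_rep_idem)
  finally show ?thesis by (simp add: insert_commute)
qed

text \<open>A side of a cut that colour \<open>p\<close> does not cross is closed under edges of
  colour \<open>p\<close>, so no component meets both sides.\<close>

lemma not_spans_components:
  assumes "\<not> spans V c p"
  obtains x y where "x \<in> V" "y \<in> V" "component_rep V c p x \<noteq> component_rep V c p y"
proof -
  from assms obtain A where A: "A \<subseteq> V" "A \<noteq> {}" "A \<noteq> V" "\<forall>x\<in>A. \<forall>y\<in>V - A. c {x, y} \<noteq> p"
    unfolding spans_def by blast
  then obtain x y where xy: "x \<in> A" "y \<in> V" "y \<notin> A" by blast
  have stay: "z \<in> A" if "(x, z) \<in> (colour_rel V c p)\<^sup>*" for z
    using that by induction (use xy A in \<open>auto simp: colour_rel_def\<close>)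
  have "component_rep V c p x \<noteq> component_rep V c p y"
  proof
    assume "component_rep V c p x = component_rep V c p y"
    then have "(x, component_rep V c p y) \<in> (colour_rel V c p)\<^sup>*" by (metis component_rep_rel)
    moreover have "(component_rep V c p y, y) \<in> (colour_rel V c p)\<^sup>*"
      using component_rep_rel sym_colour_rel by (meson symD)
    ultimately have "(x, y) \<in> (colour_rel V c p)\<^sup>*" by (rule rtrancl_trans)
    then show False using stay xy by blast
  qed
  then show ?thesis using that xy A by blast
qed

text \<open>On \<open>V\<close> the colour \<open>p\<close> falls apart into components that are
  joined only through \<open>v\<close>. A neighbour of \<open>v\<close> in colour \<open>q\<close>
  sends only \<open>q\<close> to the other components, likewise for \<open>r\<close>, and comparing
  two such neighbours gives a contradiction.\<close>

lemma spans_insert_aux: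
  assumes g: "gallai_on (insert v V) c" and v: "v \<notin> V"
    and p: "spans (insert v V) c p" "\<not> spans V c p"
    and q: "spans (insert v V) c q" "p \<noteq> q" and r: "spans (insert v V) c r" "p \<noteq> r" "q \<noteq> r"
  shows False
proof -
  let ?R = "component_rep V c p"
  have gV: "gallai_on V c" using g by (rule gallai_on_subset) auto
  from not_spans_components[OF p(2)] obtain x y where xy: "x \<in> V" "y \<in> V" "?R x \<noteq> ?R y" by blast
  \<comment> \<open>An edge of colour \<open>p\<close> leaving the component of \<open>u\<close> can
    only lead to \<open>v\<close>.\<close>
  have seesp: "\<exists>w\<in>V. ?R w = ?R u \<and> c {v, w} = p" if u: "u \<in> V" for u
  proof -
    let ?C = "{w \<in> V. ?R w = ?R u}"
    from p(1) obtain w z where wz: "w \<in> ?C" "z \<in> insert v V" "z \<notin> ?C" "c {w, z} = p"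
      by (rule spansD[of _ _ _ ?C]) (use u v in auto)
    have "z \<notin> V"
    proof
      assume z: "z \<in> V"
      then have "?R w = ?R z" using wz by (intro component_rep_edge) auto
      then show False using wz z by auto
    qed
    then show ?thesis using wz by (auto simp: insert_commute)
  qed
  have sees: "\<exists>u\<in>V. c {v, u} = q" if "spans (insert v V) c q" for q
  proof -
    from that obtain w z where wz: "w \<in> {v}" "z \<in> insert v V" "z \<notin> {v}" "c {w, z} = q"
      by (rule spansD[of _ _ _ "{v}"]) (use v xy in auto)
    then show ?thesis by auto
  qed
  \<comment> \<open>The component of \<open>w\<close> has a vertex \<open>w'\<close> joined to
    \<open>v\<close> in colour \<open>p\<close>. The triangle on \<open>v\<close>, \<open>u\<close>,
    \<open>w'\<close> gives \<open>c {u, w'} = q\<close>, and all edges between the two components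
    have one colour.\<close>
  have key: "c {u, w} = q" if u: "u \<in> V" "c {v, u} = q" "p \<noteq> q" and w: "w \<in> V" "?R w \<noteq> ?R u"
    for u w q
  proof -
    from seesp[OF w(1)] obtain w' where w': "w' \<in> V" "?R w' = ?R w" "c {v, w'} = p" by blast
    have "c {u, w'} \<noteq> p" using component_rep_edge[of u V w' c p] u w w' by auto
    moreover have "u \<noteq> w'" "v \<noteq> u" "v \<noteq> w'" using u w w' v by auto
    ultimately have "c {u, w'} = q"
      using gallai_onD[OF g, of v u w'] u w' by auto
    moreover have "c {u, w} = c {?R u, ?R w}"
      by (rule colour_between_components[OF gV u(1) w(1) w(2)[symmetric]])
    moreover have "c {u, w'} = c {?R u, ?R w'}"
      by (rule colour_between_components[OF gV u(1) w'(1)]) (use w w' in metis)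
    ultimately show ?thesis using w'(2) by metis
  qed
  from sees[OF q(1)] obtain u where u: "u \<in> V" "c {v, u} = q" by blast
  from sees[OF r(1)] obtain u' where u': "u' \<in> V" "c {v, u'} = r" by blast
  show False
  \<comment> \<open>In different components, the edge \<open>{u, u'}\<close> would have both colours
    \<open>q\<close> and \<open>r\<close>; in the same one, the edges to any other component
    would.\<close>
  proof (cases "?R u = ?R u'")
    case False
    then have "c {u, u'} = q" "c {u', u} = r" using key u u' q r by auto
    then show False using r(3) by (simp add: insert_commute)
  next
    case True
    obtain w where w: "w \<in> V" "?R w \<noteq> ?R u" using xy by metis
    then have "c {u, w} = q" "c {u', w} = r" using key u u' q r True by auto
    moreover have "c {u, w} = c {?R u, ?R w}"
      by (rule colour_between_components[OF gV u(1) w(1) w(2)[symmetric]])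
    moreover have "c {u', w} = c {?R u', ?R w}"
      by (rule colour_between_components[OF gV u'(1) w(1)]) (use w True in metis)
    ultimately show False using r(3) True by metis
  qed
qed

text \<open>By \<open>spans_insert_aux\<close>, deleting a vertex keeps all three colours spanning.
  This ends with two vertices, whose only edge has a single colour.\<close>

lemma no_three_spanning_colours:
  assumes "finite V" "2 \<le> card V" "gallai_on V c" "spans V c p" "spans V c q" "spans V c r"
    and "p \<noteq> q" "p \<noteq> r" "q \<noteq> r"
  shows False
  using assms
proof (induction V rule: finite_induct)
  case (insert v V)
  have gV: "gallai_on V c" using insert.prems(2) by (rule gallai_on_subset) auto
  show ?case
  proof (cases "2 \<le> card V")
    case True
    with insert.IH gV insert.prems have "\<not> spans V c p \<or> \<not> spans V c q \<or> \<not> spans V c r" by blast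
    then show ?thesis
      using spans_insert_aux[OF insert.prems(2) insert.hyps(2)] insert.prems by metis
  next
    case False
    with insert have "card V = 1" by simp
    then obtain u where u: "V = {u}" by (rule card_1_singletonE)
    have "c {v, u} = q" if "spans (insert v V) c q" for q
      by (rule spansD[OF that, of "{v}"]) (use u insert.hyps in auto)
    then show ?thesis using insert.prems by metis
  qed
qed simp

text \<open>Contracting the components of a colour that does not span preserves all hypotheses and
  lifts spanning colours back.\<close>

lemma gallai_two_coloured_cut:
  assumes "finite V" "2 \<le> card V" "gallai_on V c"
  shows "\<exists>A p q. A \<subseteq> V \<and> A \<noteq> {} \<and> A \<noteq> V \<and> spans V c p \<and> spans V c q \<and>
    (\<forall>x\<in>A. \<forall>y\<in>V - A. c {x, y} \<in> {p, q})"
  using assms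
proof (induction "card V" arbitrary: V rule: less_induct)
  case less
  show ?case
  proof (cases "\<exists>u\<in>V. \<exists>w\<in>V. u \<noteq> w \<and> \<not> spans V c (c {u, w})")
    case True
    then obtain u w p where uw: "u \<in> V" "w \<in> V" "u \<noteq> w" "c {u, w} = p" "\<not> spans V c p" by blast
    let ?R = "component_rep V c p"
    define T where "T = ?R ` V"
    have TV: "T \<subseteq> V" by (auto simp: T_def component_rep_in)
    have fT: "finite T" using TV less.prems finite_subset by blast
    have RT: "?R t = t" if "t \<in> T" for t using that by (auto simp: T_def component_rep_idem)
    \<comment> \<open>The edge \<open>{u, w}\<close> has colour \<open>p\<close>, so its ends share
      a representative and the contraction is strictly smaller.\<close>
    have "\<not> inj_on ?R V" using uw(1-3) component_rep_edge[of u V w c p, OF uw(1-4)] by (auto simp: inj_on_def)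
    then have cT: "card T < card V"
      unfolding T_def using less.prems(1) by (metis card_image_le eq_card_imp_inj_on le_neq_implies_less)
    from not_spans_components[OF uw(5)] obtain x y where xy: "x \<in> V" "y \<in> V" "?R x \<noteq> ?R y" by blast
    have c2: "2 \<le> card T"
    proof -
      have "card {?R x, ?R y} \<le> card T" using xy fT by (intro card_mono) (auto simp: T_def)
      then show ?thesis using xy by simp
    qed
    from less.hyps[OF cT fT c2 gallai_on_subset[OF less.prems(3) TV]]
    obtain A q r where A: "A \<subseteq> T" "A \<noteq> {}" "A \<noteq> T" "spans T c q" "spans T c r"
      "\<forall>x\<in>A. \<forall>y\<in>T - A. c {x, y} \<in> {q, r}" by blast
    have cross: "c {x, y} = c {?R x, ?R y}" if "x \<in> V" "y \<in> V" "?R x \<noteq> ?R y" for x y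
      using less.prems(3) that by (rule colour_between_components)
    have lift: "spans V c q" if q: "spans T c q" for q
      unfolding spans_def
    proof (intro allI impI)
      fix C assume C: "C \<subseteq> V" "C \<noteq> {}" "C \<noteq> V"
      show "\<exists>x\<in>C. \<exists>y\<in>V - C. c {x, y} = q"
      proof (cases "\<exists>x\<in>C. \<exists>y\<in>V - C. ?R x = ?R y")
        case True
        \<comment> \<open>\<open>C\<close> splits a component. An edge of colour \<open>q\<close>
          from its representative to some \<open>t\<close> gives such edges from both
          \<open>x\<close> and \<open>y\<close> to \<open>t\<close>, and one of these
          crosses.\<close>
        then obtain x y where xy: "x \<in> C" "y \<in> V" "y \<notin> C" "?R x = ?R y" by blast
        have xT: "?R x \<in> T" using xy C by (auto simp: T_def)
        have T: "T \<noteq> {?R x}" using c2 by auto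
        from q obtain a t where t: "a \<in> {?R x}" "t \<in> T" "t \<notin> {?R x}" "c {a, t} = q"
          by (rule spansD[of _ _ _ "{?R x}"]) (use xT T in auto)
        have tV: "t \<in> V" "?R t = t" using t TV RT by auto
        have "c {x, t} = q" "c {y, t} = q"
          using cross[of x t] cross[of y t] xy C t tV by auto
        then have "c {x, t} = q" "c {t, y} = q" by (simp_all add: insert_commute)
        then show ?thesis using xy tV by (cases "t \<in> C") blast+
      next
        \<comment> \<open>\<open>C\<close> is a union of components, so its trace on
          \<open>T\<close> is a proper cut of \<open>T\<close>.\<close>
        case sat: False
        have inC: "?R x \<in> C \<longleftrightarrow> x \<in> C" if "x \<in> V" for x
        proof -
          have "?R x \<in> V" "?R (?R x) = ?R x"
            using that by (simp_all add: component_rep_in component_rep_idem)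
          then show ?thesis using sat[simplified, rule_format, of x "?R x"]
            sat[simplified, rule_format, of "?R x" x] that by auto
        qed
        obtain x where x: "x \<in> C" using C by blast
        then have ne1: "?R x \<in> C \<inter> T" using inC C by (auto simp: T_def)
        obtain y where y: "y \<in> V" "y \<notin> C" using C by blast
        then have ne2: "?R y \<in> T" "?R y \<notin> C" using inC by (auto simp: T_def)
        obtain x' y' where "x' \<in> C \<inter> T" "y' \<in> T" "y' \<notin> C \<inter> T" "c {x', y'} = q"
          by (rule spansD[OF q, of "C \<inter> T"]) (use ne1 ne2 in blast)+
        then show ?thesis using TV by blast
      qed
    qed
    let ?A = "{x \<in> V. ?R x \<in> A}"
    have "?A \<noteq> {}"
    proof -
      obtain t where t: "t \<in> A" using A by blast
      then have "t \<in> V" "?R t = t" using A(1) TV RT by auto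
      with t have "t \<in> ?A" by simp
      then show ?thesis by blast
    qed
    moreover have "?A \<noteq> V"
    proof
      assume "?A = V"
      then have "T \<subseteq> A" by (auto simp: T_def)
      then show False using A by auto
    qed
    moreover have "\<forall>x\<in>?A. \<forall>y\<in>V - ?A. c {x, y} \<in> {q, r}"
    proof (intro ballI)
      fix x y assume x: "x \<in> ?A" and y: "y \<in> V - ?A"
      then have "?R x \<noteq> ?R y" "?R y \<in> T - A" by (auto simp: T_def)
      moreover have "x \<in> V" "y \<in> V" "?R x \<in> A" using x y by auto
      ultimately have "c {x, y} = c {?R x, ?R y}" "c {?R x, ?R y} \<in> {q, r}" using cross A(6) by blast+
      then show "c {x, y} \<in> {q, r}" by simp
    qed
    moreover have "spans V c q" "spans V c r" using lift A(4,5) by simp_all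
    moreover have "?A \<subseteq> V" by simp
    ultimately show ?thesis by blast
  next
    \<comment> \<open>Every colour that occurs now spans, so at most two occur at a vertex
      \<open>v\<close>, and \<open>{v}\<close> is the cut.\<close>
    case False
    then have all: "spans V c (c {u, w})" if "u \<in> V" "w \<in> V" "u \<noteq> w" for u w using that by blast
    obtain v w where vw: "v \<in> V" "w \<in> V" "v \<noteq> w"
      using less.prems(2) card_le_Suc0_iff_eq[OF less.prems(1)] by fastforce
    define p where "p = c {v, w}"
    obtain q where q: "spans V c q" "\<forall>y\<in>V - {v}. c {v, y} \<in> {p, q}"
    proof (cases "\<exists>y\<in>V - {v}. c {v, y} \<noteq> p")
      case False
      then show ?thesis using that[of p] all[OF vw] unfolding p_def by blast
    next
      case True
      then obtain y where y: "y \<in> V" "y \<noteq> v" "c {v, y} \<noteq> p" by blast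
      show ?thesis
      proof (rule that[of "c {v, y}"])
        show "spans V c (c {v, y})" using all vw y by blast
        show "\<forall>z\<in>V - {v}. c {v, z} \<in> {p, c {v, y}}"
        proof (rule ballI, rule ccontr)
          fix z assume z: "z \<in> V - {v}" "c {v, z} \<notin> {p, c {v, y}}"
          have "spans V c p" unfolding p_def by (rule all[OF vw])
          moreover have "spans V c (c {v, y})" by (rule all[OF vw(1) y(1) y(2)[symmetric]])
          moreover have "spans V c (c {v, z})" by (rule all) (use vw z in auto)
          ultimately show False
            by (rule no_three_spanning_colours[OF less.prems]) (use y z in auto)
        qed
      qed
    qed
    have "spans V c p" using all[OF vw] by (simp add: p_def)
    moreover have "{v} \<subseteq> V" "{v} \<noteq> {}" "{v} \<noteq> V" using vw by auto
    moreover have "\<forall>x\<in>{v}. \<forall>y\<in>V - {v}. c {x, y} \<in> {p, q}" using q(2) by simp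
    ultimately show ?thesis using q(1) by blast
  qed
qed

section \<open>The lower bound\<close>

text \<open>Grow a set from one vertex: some edge of colour \<open>p\<close> always leaves it, so
  each further vertex brings a new edge.\<close>

lemma card_spanning_colour:
  assumes fin: "finite V" and V: "V \<noteq> {}" and sp: "spans V c p"
  shows "card V \<le> Suc (card {d \<in> nsets V 2. c d = p})"
proof -
  have grow: "\<exists>A\<subseteq>V. card A = Suc j \<and> j \<le> card {d \<in> nsets A 2. c d = p}" if "j < card V" for j
    using that
  proof (induction j)
    case 0
    obtain v where "v \<in> V" using V by blast
    then show ?case by (intro exI[of _ "{v}"]) auto
  next
    case (Suc j)
    then obtain A where A: "A \<subseteq> V" "card A = Suc j" "j \<le> card {d \<in> nsets A 2. c d = p}" by auto
    have "A \<noteq> {}" "A \<noteq> V" using A Suc.prems by auto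
    with sp A(1) obtain x y where xy: "x \<in> A" "y \<in> V" "y \<notin> A" "c {x, y} = p" by (rule spansD)
    have fA: "finite A" using A fin finite_subset by blast
    have "{x, y} \<in> nsets (insert y A) 2" using xy by (simp add: nsets_2_eq) blast
    then have "insert {x, y} {d \<in> nsets A 2. c d = p} \<subseteq> {d \<in> nsets (insert y A) 2. c d = p}"
      using xy by (auto simp: nsets_def)
    moreover have "finite {d \<in> nsets (insert y A) 2. c d = p}"
      using fA by (simp add: finite_imp_finite_nsets)
    ultimately have "card (insert {x, y} {d \<in> nsets A 2. c d = p}) \<le> card {d \<in> nsets (insert y A) 2. c d = p}"
      by (rule card_mono[rotated])
    moreover have "{x, y} \<notin> {d \<in> nsets A 2. c d = p}" using xy by (auto simp: nsets_def)
    moreover have "finite {d \<in> nsets A 2. c d = p}" using fA by (simp add: finite_imp_finite_nsets)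
    ultimately have "Suc j \<le> card {d \<in> nsets (insert y A) 2. c d = p}" using A by simp
    then show ?case using A xy fA by (intro exI[of _ "insert y A"]) auto
  qed
  have "card V - 1 < card V" using fin V by (simp add: card_gt_0_iff)
  from grow[OF this] obtain A where A: "A \<subseteq> V" "card V - 1 \<le> card {d \<in> nsets A 2. c d = p}" by blast
  have "card {d \<in> nsets A 2. c d = p} \<le> card {d \<in> nsets V 2. c d = p}"
    using A fin by (intro card_mono) (auto simp: nsets_def)
  then show ?thesis using A by linarith
qed

text \<open>Cut repeatedly and keep the larger side. The logarithm pays for the edges inside the
  sides cut off, the square for what is left at the end.\<close>

lemma card_small_edges:
  fixes M t :: nat
  assumes fin: "finite W" and g: "gallai_on W c"
    and M: "\<And>p. card {d \<in> nsets W 2. c d = p} \<le> M"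
    and t: "\<And>p. p \<in> S \<Longrightarrow> card {d \<in> nsets W 2. c d = p} \<le> t"
    and V: "V \<subseteq> W" "V \<noteq> {}"
  shows "real (card {d \<in> nsets V 2. c d \<in> S}) \<le> 2 * real M * ln (real (card V)) + (real t + 1)\<^sup>2 / 2"
  using V
proof (induction "card V" arbitrary: V rule: less_induct)
  case less
  define s where "s = card V"
  have fV: "finite V" using less.prems fin finite_subset by blast
  have s1: "1 \<le> s" using fV less.prems by (simp add: s_def Suc_le_eq card_gt_0_iff)
  show ?case
  proof (cases "s \<le> t + 1")
    \<comment> \<open>So few vertices that a colour in \<open>S\<close> might span: all edges are
      counted.\<close>
    case True
    have "card {d \<in> nsets V 2. c d \<in> S} \<le> card (nsets V 2)"
      using fV by (intro card_mono) (auto simp: finite_imp_finite_nsets)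
    also have "\<dots> = s choose 2" by (simp add: s_def)
    finally have "real (card {d \<in> nsets V 2. c d \<in> S}) \<le> real (s choose 2)" by simp
    also have "\<dots> \<le> (real s)\<^sup>2 / 2" by (simp add: real_choose_two power2_eq_square algebra_simps)
    also have "\<dots> \<le> (real t + 1)\<^sup>2 / 2" using True by (intro divide_right_mono power_mono) auto
    finally show ?thesis using s1 by (simp add: s_def add_increasing)
  next
    case False
    then have c2: "2 \<le> card V" by (simp add: s_def)
    from gallai_two_coloured_cut[OF fV c2 gallai_on_subset[OF g less.prems(1)]]
    obtain A0 p q where A0: "A0 \<subseteq> V" "A0 \<noteq> {}" "A0 \<noteq> V" "spans V c p" "spans V c q"
      "\<forall>x\<in>A0. \<forall>y\<in>V - A0. c {x, y} \<in> {p, q}" by blast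
    have "\<exists>A\<subseteq>V. A \<noteq> {} \<and> A \<noteq> V \<and> card A \<le> card (V - A) \<and> (\<forall>x\<in>A. \<forall>y\<in>V - A. c {x, y} \<in> {p, q})"
    proof (cases "card A0 \<le> card (V - A0)")
      case True
      then show ?thesis using A0 by blast
    next
      case False
      have "V - (V - A0) = A0" using A0 by blast
      moreover have "\<forall>x\<in>V - A0. \<forall>y\<in>A0. c {x, y} \<in> {p, q}"
      proof (intro ballI)
        fix x y assume "x \<in> V - A0" "y \<in> A0"
        then have "c {y, x} \<in> {p, q}" using A0(6) by blast
        then show "c {x, y} \<in> {p, q}" by (simp only: insert_commute)
      qed
      ultimately show ?thesis using False A0
        by (intro exI[of _ "V - A0"]) auto
    qed
    then obtain A where A: "A \<subseteq> V" "A \<noteq> {}" "A \<noteq> V" "card A \<le> card (V - A)"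
      "\<forall>x\<in>A. \<forall>y\<in>V - A. c {x, y} \<in> {p, q}" by blast
    define a where "a = card A"
    have fA: "finite A" using A fV finite_subset by blast
    have cB: "card (V - A) = s - a" using A fA by (simp add: card_Diff_subset s_def a_def)
    have a1: "1 \<le> a" using A fA by (simp add: a_def Suc_le_eq card_gt_0_iff)
    have a2: "2 * a \<le> s" using A(4) cB a1 by (simp add: a_def) 
    \<comment> \<open>A spanning colour has at least \<open>s - 1\<close> edges, more than
      \<open>t\<close>, so no edge across the cut has a colour in \<open>S\<close>.\<close>
    have notS: "r \<notin> S" if r: "spans V c r" for r
    proof
      assume "r \<in> S"
      have "s \<le> Suc (card {d \<in> nsets V 2. c d = r})"
        unfolding s_def using fV less.prems(2) r by (rule card_spanning_colour)
      also have "card {d \<in> nsets V 2. c d = r} \<le> card {d \<in> nsets W 2. c d = r}"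
        using less.prems fin by (intro card_mono) (auto simp: nsets_def)
      also have "\<dots> \<le> t" using \<open>r \<in> S\<close> by (rule t)
      finally show False using False by simp
    qed
    have cross: "a * (s - a) \<le> 2 * M"
    proof -
      have "card (A \<times> (V - A)) = card ((\<lambda>(x, y). {x, y}) ` (A \<times> (V - A)))"
        by (intro card_image[symmetric]) (auto simp: inj_on_def doubleton_eq_iff)
      also have "\<dots> \<le> card ({d \<in> nsets W 2. c d = p} \<union> {d \<in> nsets W 2. c d = q})"
      proof (rule card_mono)
        show "finite ({d \<in> nsets W 2. c d = p} \<union> {d \<in> nsets W 2. c d = q})"
          using fin by (simp add: finite_imp_finite_nsets)
        show "(\<lambda>(x, y). {x, y}) ` (A \<times> (V - A)) \<subseteq> {d \<in> nsets W 2. c d = p} \<union> {d \<in> nsets W 2. c d = q}"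
        proof
          fix d assume "d \<in> (\<lambda>(x, y). {x, y}) ` (A \<times> (V - A))"
          then obtain x y where d: "d = {x, y}" "x \<in> A" "y \<in> V - A" by auto
          then have "c d \<in> {p, q}" "d \<in> nsets W 2"
            using A less.prems by (auto simp: nsets_def card_2_iff)
          then show "d \<in> {d \<in> nsets W 2. c d = p} \<union> {d \<in> nsets W 2. c d = q}" by auto
        qed
      qed
      also have "\<dots> \<le> card {d \<in> nsets W 2. c d = p} + card {d \<in> nsets W 2. c d = q}"
        by (rule card_Un_le)
      also have "\<dots> \<le> M + M" by (intro add_mono M)
      finally show ?thesis by (simp add: card_cartesian_product cB a_def)
    qed
    have "card {d \<in> nsets V 2. c d \<in> S} \<le> card (nsets A 2 \<union> {d \<in> nsets (V - A) 2. c d \<in> S})"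
    proof (rule card_mono)
      show "finite (nsets A 2 \<union> {d \<in> nsets (V - A) 2. c d \<in> S})"
        using fA fV by (simp add: finite_imp_finite_nsets)
      show "{d \<in> nsets V 2. c d \<in> S} \<subseteq> nsets A 2 \<union> {d \<in> nsets (V - A) 2. c d \<in> S}"
      proof
        fix d assume d: "d \<in> {d \<in> nsets V 2. c d \<in> S}"
        then obtain x y where xy: "d = {x, y}" "x \<noteq> y" "x \<in> V" "y \<in> V" "c d \<in> S"
          by (auto simp: nsets_def card_2_iff)
        have notpq: "c d \<notin> {p, q}" using xy(5) notS A0(4,5) by auto
        have "\<not> (x \<in> A \<and> y \<notin> A)" using A(5) xy(1,4) notpq by auto
        moreover have "\<not> (y \<in> A \<and> x \<notin> A)"
        proof
          assume "y \<in> A \<and> x \<notin> A"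
          then have "c {y, x} \<in> {p, q}" using A(5) xy by blast
          moreover have "d = {y, x}" using xy(1) by blast
          ultimately show False using notpq by simp
        qed
        ultimately show "d \<in> nsets A 2 \<union> {d \<in> nsets (V - A) 2. c d \<in> S}"
          using xy by (auto simp: nsets_def)
      qed
    qed
    also have "\<dots> \<le> card (nsets A 2) + card {d \<in> nsets (V - A) 2. c d \<in> S}" by (rule card_Un_le)
    also have "card (nsets A 2) = a choose 2" by (simp add: a_def)
    finally have split: "real (card {d \<in> nsets V 2. c d \<in> S}) \<le>
       real (a choose 2) + real (card {d \<in> nsets (V - A) 2. c d \<in> S})"
      unfolding of_nat_add[symmetric] by (rule of_nat_mono)
    have rs: "real (s - a) = real s - real a" using a2 by (intro of_nat_diff) simp
    have pos: "0 < real s" "0 < real s - real a" using s1 a1 a2 by auto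
    \<comment> \<open>As \<open>a\<close> is at most \<open>s / 2\<close>,
      \<open>a * s / 2 \<le> a * (s - a) \<le> 2 * M\<close>, hence
      \<open>a\<^sup>2 / 2 \<le> 2 * M * (a / s)\<close>. The bound
      \<open>a / s \<le> ln s - ln (s - a)\<close> makes the sum telescope.\<close>
    have "real (a choose 2) \<le> 2 * real M * (ln (real s) - ln (real s - real a))"
    proof -
      have "real a * real (s - a) \<le> 2 * real M"
        using of_nat_mono[OF cross, where 'a = real] by simp
      then have "real a * (real s - real a) \<le> 2 * real M" by (simp only: rs)
      moreover have "real a * (real s / 2) \<le> real a * (real s - real a)"
        using a2 by (intro mult_left_mono) auto
      ultimately have "real a / 2 \<le> 2 * real M / real s" using pos by (simp add: field_simps)
      then have "real a * (real a / 2) \<le> real a * (2 * real M / real s)" by (rule mult_left_mono) simp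
      moreover have "real (a choose 2) \<le> real a * (real a / 2)"
        by (simp add: real_choose_two algebra_simps)
      moreover have "real a * (2 * real M / real s) = 2 * real M * (real a / real s)" by simp
      moreover have "real a / real s \<le> ln (real s) - ln (real s - real a)"
      proof -
        have "ln ((real s - real a) / real s) \<le> (real s - real a) / real s - 1"
          using pos by (intro ln_le_minus_one) auto
        also have "\<dots> = - (real a / real s)" using pos by (simp add: field_simps)
        finally show ?thesis using pos by (simp add: ln_div)
      qed
      then have "2 * real M * (real a / real s) \<le> 2 * real M * (ln (real s) - ln (real s - real a))"
        by (rule mult_left_mono) simp
      ultimately show ?thesis by linarith
    qed
    moreover have "real (card {d \<in> nsets (V - A) 2. c d \<in> S}) \<le>
        2 * real M * ln (real s - real a) + (real t + 1)\<^sup>2 / 2"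
    proof -
      have "real (card {d \<in> nsets (V - A) 2. c d \<in> S}) \<le>
        2 * real M * ln (real (card (V - A))) + (real t + 1)\<^sup>2 / 2"
      proof (rule less.hyps)
        show "card (V - A) < card V" using cB a1 a2 by (simp add: s_def)
        show "V - A \<subseteq> W" "V - A \<noteq> {}" using less.prems A by auto
      qed
      then show ?thesis by (simp only: cB rs)
    qed
    ultimately show ?thesis using split by (simp add: s_def algebra_simps)
  qed
qed

section \<open>A colour distribution that no Gallai colouring attains\<close>

lemma gallai_onI:
  assumes "gallai_colouring n k c"
  shows "gallai_on {..<n} c"
  unfolding gallai_on_def
proof (intro ballI impI)
  fix x y z assume *: "x \<in> {..<n}" "y \<in> {..<n}" "z \<in> {..<n}" "x \<noteq> y" "y \<noteq> z" "x \<noteq> z"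
  have "\<not> rainbow_triangle n c x y z" using assms by (auto simp: gallai_colouring_def)
  with * show "c {x, y} = c {y, z} \<or> c {y, z} = c {x, z} \<or> c {x, y} = c {x, z}"
    unfolding rainbow_triangle_def by auto
qed

text \<open>The colours up to \<open>h\<close> get \<open>t\<close> edges each and the others share
  the rest evenly. By \<open>big\<close>, this violates \<open>card_small_edges\<close> for the set
  of the first \<open>h\<close> colours.\<close>

lemma not_gallai_threshold:
  fixes k n :: nat
  defines "h \<equiv> k div 2"
  defines "t \<equiv> h div 2"
  defines "M \<equiv> ((n choose 2) - h * t) div (k - h) + k"
  assumes k: "2 \<le> k" and n: "1 \<le> n" and ht: "h * t \<le> n choose 2"
    and big: "2 * real M * ln (real n) + (real t + 1)\<^sup>2 / 2 < real (h * t)"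
  shows "\<not> gallai_threshold k n"
proof
  assume "gallai_threshold k n"
  define R l where "R = (n choose 2) - h * t" and "l = k - h"
  have l: "0 < l" "l \<le> k" "h < k" using k by (auto simp: l_def h_def)
  \<comment> \<open>The remainder of the division goes to colour \<open>k\<close>; the summand
    \<open>k\<close> in \<open>M\<close> covers both this remainder and \<open>t\<close>.\<close>
  define e where "e i = (if i \<le> h then t else R div l + (if i = k then R mod l else 0))" for i
  have "(\<Sum>i=1..k. e i) = (\<Sum>i=1..h. e i) + (\<Sum>i=h+1..k. e i)"
    using l sum.ub_add_nat[of 1 h e "k - h"] by simp
  also have "(\<Sum>i=1..h. e i) = h * t" by (simp add: e_def)
  also have "(\<Sum>i=h+1..k. e i) = (\<Sum>i=h+1..k. R div l + (if i = k then R mod l else 0))"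
    by (intro sum.cong) (auto simp: e_def)
  also have "\<dots> = l * (R div l) + R mod l" using l by (simp add: sum.distrib l_def)
  also have "\<dots> = R" by simp
  also have "h * t + R = n choose 2" using ht by (simp add: R_def)
  finally obtain c where c: "gallai_colouring n k c" "has_colour_distribution n k c e"
    using \<open>gallai_threshold k n\<close> unfolding gallai_threshold_def by blast
  have dist: "card {d \<in> nsets {..<n} 2. c d = p} = e p" if "p \<in> {1..k}" for p
    using c(2) that by (simp add: has_colour_distribution_def complete_edges_def)
  have out: "card {d \<in> nsets {..<n} 2. c d = p} = 0" if "p \<notin> {1..k}" for p
  proof -
    have "{d \<in> nsets {..<n} 2. c d = p} = {}"
      using c(1) that by (auto simp: gallai_colouring_def edge_colouring_def complete_edges_def)
    then show ?thesis by (simp only: card.empty)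
  qed
  have eM: "e p \<le> M" for p
  proof -
    have "t \<le> k" by (simp add: t_def h_def div_le_dividend le_trans)
    moreover have "R mod l \<le> k" using l by (meson le_trans less_imp_le mod_less_divisor)
    ultimately show ?thesis by (simp add: e_def M_def R_def l_def)
  qed
  have "real (card {d \<in> nsets {..<n} 2. c d \<in> {1..h}}) \<le>
     2 * real M * ln (real (card {..<n})) + (real t + 1)\<^sup>2 / 2"
  proof (rule card_small_edges[of "{..<n}"])
    show "gallai_on {..<n} c" using c(1) by (rule gallai_onI)
    show "card {d \<in> nsets {..<n} 2. c d = p} \<le> M" for p
      using dist[of p] out[of p] eM[of p] by (cases "p \<in> {1..k}") auto
    show "card {d \<in> nsets {..<n} 2. c d = p} \<le> t" if "p \<in> {1..h}" for p
      using dist[of p] that l by (simp add: e_def)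
    show "{..<n} \<noteq> {}" using n by (simp add: lessThan_empty_iff bot_nat_def)
  qed auto
  moreover have "card {d \<in> nsets {..<n} 2. c d \<in> {1..h}} = h * t"
  proof -
    have "{d \<in> nsets {..<n} 2. c d \<in> {1..h}} = (\<Union>i\<in>{1..h}. {d \<in> nsets {..<n} 2. c d = i})" by auto
    also have "card \<dots> = (\<Sum>i\<in>{1..h}. card {d \<in> nsets {..<n} 2. c d = i})"
      by (intro card_UN_disjoint) (auto simp: finite_imp_finite_nsets)
    also have "\<dots> = (\<Sum>i\<in>{1..h}. t)" using l by (intro sum.cong) (auto simp: dist e_def)
    finally show ?thesis by simp
  qed
  ultimately show False using big by simp
qed

lemma gallai_threshold_mono: "gallai_threshold k N \<Longrightarrow> N \<le> n \<Longrightarrow> gallai_threshold k n"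
  unfolding gallai_threshold_def by auto

lemma eventually_not_gallai_threshold:
  "\<forall>\<^sub>F k in sequentially.
     \<not> gallai_threshold k (nat \<lfloor>1/8 * (real k powr (3/2) / (ln (real k)) powr (1/2))\<rfloor>)"
proof -
  \<comment> \<open>With 1/8, the term \<open>2 * (x\<^sup>2 / k) * (2 * ln k)\<close> is
    \<open>k\<^sup>2 / 16\<close>. Adding about \<open>k\<^sup>2 / 32\<close> for the square of
    \<open>t\<close> leaves a margin of about \<open>k\<^sup>2 / 32\<close> below
    \<open>h * t\<close>, which is about \<open>k\<^sup>2 / 8\<close>; the third estimate below fits
    the lower order terms into it.\<close>
  define x where "x k = 1/8 * (real k powr (3/2) / (ln (real k)) powr (1/2))" for k :: nat
  have ev: "\<forall>\<^sub>F k in sequentially. real k + 1 \<le> x k"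
    "\<forall>\<^sub>F k in sequentially. x k \<le> (real k)\<^sup>2"
    "\<forall>\<^sub>F k in sequentially. 4 * real k * ln (real k) + real k < 1/32 * (real k)\<^sup>2"
    unfolding x_def by real_asymp+
  show ?thesis
    using ev eventually_ge_at_top[of "3 :: nat"]
  proof eventually_elim
    case (elim k)
    define n where "n = nat \<lfloor>x k\<rfloor>"
    have n: "real n \<le> x k" "x k - 1 \<le> real n" using elim unfolding n_def by linarith+
    have nk: "k \<le> n" using n elim by linarith
    define h t where "h = k div 2" and "t = h div 2"
    have half: "(real j - 1) / 2 \<le> real (j div 2)" "real (j div 2) \<le> real j / 2" for j
      by (cases "even j"; auto elim!: evenE oddE)+
    have hb: "(real k - 1) / 2 \<le> real h" "real h \<le> real k / 2" unfolding h_def by (rule half)+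
    have tb: "(real h - 1) / 2 \<le> real t" "real t \<le> real h / 2" unfolding t_def by (rule half)+
    have ht: "h * t \<le> n choose 2"
    proof -
      have "real h * real t \<le> (real k / 2) * (real k / 4)"
        using hb tb by (intro mult_mono) auto
      also have "\<dots> \<le> real k * (real k - 1) / 2" using elim(4) by (simp add: field_simps)
      also have "\<dots> \<le> real n * (real n - 1) / 2"
        using nk elim(4) by (intro divide_right_mono mult_mono) auto
      also have "\<dots> = real (n choose 2)" by (simp add: real_choose_two)
      finally have "real (h * t) \<le> real (n choose 2)" by simp
      then show ?thesis by (simp only: of_nat_le_iff)
    qed
    define M where "M = ((n choose 2) - h * t) div (k - h) + k"
    have Mb: "real M \<le> (x k)\<^sup>2 / real k + real k"
    proof -
      have kh: "real k / 2 \<le> real (k - h)" using hb by simp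
      have "real (((n choose 2) - h * t) div (k - h)) \<le> real ((n choose 2) - h * t) / real (k - h)"
        by (rule of_nat_div_le_of_nat)
      also have "\<dots> \<le> ((real n)\<^sup>2 / 2) / (real k / 2)"
      proof (rule frac_le)
        have "real ((n choose 2) - h * t) \<le> real (n choose 2)" by simp
        also have "\<dots> \<le> (real n)\<^sup>2 / 2" by (simp add: real_choose_two power2_eq_square algebra_simps)
        finally show "real ((n choose 2) - h * t) \<le> (real n)\<^sup>2 / 2" .
      qed (use kh elim in auto)
      also have "\<dots> = (real n)\<^sup>2 / real k" by simp
      also have "\<dots> \<le> (x k)\<^sup>2 / real k" using n by (intro divide_right_mono power_mono) auto
      finally show ?thesis by (simp add: M_def)
    qed
    have lnn: "ln (real n) \<le> 2 * ln (real k)"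
    proof -
      have "real n \<le> (real k)\<^sup>2" using n elim(2) by linarith
      then have "ln (real n) \<le> ln ((real k)\<^sup>2)"
        using nk elim(4) by (subst ln_le_cancel_iff) auto
      also have "\<dots> = 2 * ln (real k)" using elim(4) by (simp add: ln_realpow)
      finally show ?thesis .
    qed
    have "2 * real M * ln (real n) + (real t + 1)\<^sup>2 / 2 \<le>
        2 * ((x k)\<^sup>2 / real k + real k) * (2 * ln (real k)) + (real k / 4 + 1)\<^sup>2 / 2"
      using Mb lnn nk elim(4) hb tb
      by (intro add_mono mult_mono divide_right_mono power_mono) auto
    also have "\<dots> = (real k)\<^sup>2 / 16 + 4 * real k * ln (real k) + (real k / 4 + 1)\<^sup>2 / 2"
    proof -
      have ln: "0 < ln (real k)" using elim(4) by simp
      have "(real k powr (3/2))\<^sup>2 = real k powr (3/2 + 3/2)"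
        unfolding power2_eq_square powr_add ..
      also have "\<dots> = real k ^ 3" using elim(4) by simp
      finally have "(x k)\<^sup>2 = real k ^ 3 / (64 * ln (real k))"
        using ln by (simp add: x_def power_mult_distrib power_divide powr_half_sqrt)
      then show ?thesis using ln elim(4) by (simp add: field_simps power2_eq_square power3_eq_cube)
    qed
    also have "\<dots> < ((real k - 1) / 2) * ((real k - 3) / 4)"
    proof -
      have eq: "((real k - 1) / 2) * ((real k - 3) / 4) - ((real k)\<^sup>2 / 16 + (real k / 4 + 1)\<^sup>2 / 2)
          = 1/32 * (real k)\<^sup>2 - 3/4 * real k - 1/8"
        by (simp add: power2_eq_square field_simps)
      show ?thesis using elim(3,4) eq by linarith
    qed
    also have "\<dots> \<le> real h * real t" using hb tb elim(4) by (intro mult_mono) auto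
    also have "\<dots> = real (h * t)" by simp
    finally have "\<not> gallai_threshold k n"
      using elim(4) nk ht unfolding M_def t_def h_def by (intro not_gallai_threshold) auto
    then show ?case by (simp add: n_def x_def)
  qed
qed

section \<open>The two bounds combined\<close>

theorem theorem1p2:
  shows "(\<lambda>k. real (gallai_g k)) \<in>
           \<Theta>(\<lambda>k. real k powr (3/2) / (ln (real k)) powr (1/2))"
proof (rule bigthetaI)
  define f where "f k = real k powr (3/2) / (ln (real k)) powr (1/2)" for k :: nat
  have f1: "\<forall>\<^sub>F k in sequentially. 1 \<le> f k" unfolding f_def by real_asymp
  have up: "\<forall>\<^sub>F k in sequentially. gallai_threshold k (nat \<lceil>512 * f k\<rceil>)"
    using eventually_gallai_threshold unfolding f_def .
  have low: "\<forall>\<^sub>F k in sequentially. \<not> gallai_threshold k (nat \<lfloor>1/8 * f k\<rfloor>)"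
    using eventually_not_gallai_threshold unfolding f_def .
  \<comment> \<open>As \<open>f k\<close> is at least 1, rounding up costs at most one more
    \<open>f k\<close>.\<close>
  have "\<forall>\<^sub>F k in sequentially. norm (real (gallai_g k)) \<le> 513 * norm (f k)"
    using f1 up
  proof eventually_elim
    case (elim k)
    have "gallai_g k \<le> nat \<lceil>512 * f k\<rceil>" unfolding gallai_g_def using elim(2) by (rule Least_le)
    then have "real (gallai_g k) \<le> real (nat \<lceil>512 * f k\<rceil>)" by simp
    also have "\<dots> \<le> 512 * f k + 1" using elim(1) by linarith
    also have "\<dots> \<le> 513 * f k" using elim(1) by simp
    finally show ?case using elim(1) by simp
  qed
  then show "(\<lambda>k. real (gallai_g k)) \<in> O(\<lambda>k. real k powr (3/2) / (ln (real k)) powr (1/2))"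
    unfolding f_def by (rule bigoI)
  have "\<forall>\<^sub>F k in sequentially. 1/8 * norm (f k) \<le> norm (real (gallai_g k))"
    using f1 up low
  proof eventually_elim
    case (elim k)
    \<comment> \<open>The upper bound provides some threshold, so the least one is itself a
      threshold; by monotonicity it exceeds every value that is not.\<close>
    have "gallai_threshold k (gallai_g k)" unfolding gallai_g_def using elim(2) by (rule LeastI)
    then have "\<not> gallai_g k \<le> nat \<lfloor>1/8 * f k\<rfloor>" using elim(3) gallai_threshold_mono by blast
    then have "real (nat \<lfloor>1/8 * f k\<rfloor>) + 1 \<le> real (gallai_g k)" by linarith
    then have "1/8 * f k \<le> real (gallai_g k)" by linarith
    then show ?case using elim(1) by simp
  qed
  then show "(\<lambda>k. real (gallai_g k)) \<in> \<Omega>(\<lambda>k. real k powr (3/2) / (ln (real k)) powr (1/2))"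
    unfolding f_def by (intro landau_omega.bigI[of "1/8"]) auto
qed

end
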